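(* There exist a real-valued $C^\infty$ function $V : [0,+\infty)\times\mathbb{T}^2\to\mathbb{R}$ and a $C^\infty$ function $u : [0,+\infty)\times \mathbb{T}^2\to\mathbb{C}$ such that $$i\partial_t u(t,x) = -\Delta u(t,x) + V(t,x)\,u(t,x)\qquad \text{for all } (t,x)\in[0,+\infty)\times\mathbb{T}^2,$$ and such that both of the following hold. (i) For every (small) constant $\delta>0$ and every $s>0$ there exists a constant $c_{\delta,s}>0$ such that, for all sufficiently large $t$, $$\|u(t)\|_{H^s}\geq c_{\delta,s}\,(\log t)^{s(1-\delta)}.$$ (ii) For every integer $k\geq 0$ and every real $s\geq 0$, $$\lim_{t\to\infty}\|\partial_t^k V(t,\cdot)\|_{H^s}=0.$$
   Context: $\mathbb{T}^2=\mathbb{R}^2/(2\pi\mathbb{Z})^2$ is the two-dimensional torus, $\Delta$ is the Laplacian in the space variable $x\in\mathbb{T}^2$, and $\|\cdot\|_{H^s}$ denotes the Sobolev norm of order $s$ on $\mathbb{T}^2$. The single pair $(V,u)$ works for all $\delta$, $s$ and $k$ simultaneously. *)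

theory Defs
  imports "HOL-Analysis.Analysis"
begin

text \<open>
  Functions on the torus \<open>\<real>\<^sup>2 / (2\<pi>\<int>)\<^sup>2\<close> are functions on \<open>\<real>\<^sup>2\<close> that are
  \<open>2\<pi>\<close>-periodic in each coordinate. A function on \<open>[0,\<infinity>) \<times> \<real>\<^sup>2\<close> is a total function
  \<open>real \<Rightarrow> real^2 \<Rightarrow> _\<close> of which only the values at times \<open>t \<ge> 0\<close> matter.
\<close>

definition torus_periodic :: "(real^2 \<Rightarrow> 'a) \<Rightarrow> bool" where
  "torus_periodic f \<longleftrightarrow> (\<forall>x i. f (x + axis i (2 * pi)) = f x)"

text \<open>
  Derivatives are taken within \<open>S\<close>. This is intended for sets such as \<open>[0,\<infinity>) \<times> \<real>\<^sup>2\<close>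
  on which the derivative within \<open>S\<close> is unique, boundary points included (there the
  derivative in the normal direction is one-sided).
\<close>

fun Ck_on :: "nat \<Rightarrow> ('a::euclidean_space \<Rightarrow> 'b::real_normed_vector) \<Rightarrow> 'a set \<Rightarrow> bool" where
  "Ck_on 0 f S \<longleftrightarrow> continuous_on S f"
| "Ck_on (Suc k) f S \<longleftrightarrow> f differentiable_on S \<and>
     (\<forall>v. Ck_on k (\<lambda>x. frechet_derivative f (at x within S) v) S)"

definition smooth_on_cylinder :: "(real \<Rightarrow> real^2 \<Rightarrow> 'b::real_normed_vector) \<Rightarrow> bool" where
  "smooth_on_cylinder f \<longleftrightarrow>
     (\<forall>t\<ge>0. torus_periodic (f t)) \<and>
     (\<forall>k. Ck_on k (\<lambda>(t, x). f t x) ({0..} \<times> UNIV))"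

text \<open>The time derivative on \<open>[0,\<infinity>)\<close>; at \<open>t = 0\<close> it is the right derivative.\<close>

definition time_deriv ::
    "(real \<Rightarrow> real^2 \<Rightarrow> 'b::real_normed_vector) \<Rightarrow> real \<Rightarrow> real^2 \<Rightarrow> 'b" where
  "time_deriv f t x = vector_derivative (\<lambda>\<tau>. f \<tau> x) (at t within {0..})"

definition partial_deriv :: "2 \<Rightarrow> (real^2 \<Rightarrow> 'b::real_normed_vector) \<Rightarrow> real^2 \<Rightarrow> 'b" where
  "partial_deriv i f x = vector_derivative (\<lambda>h. f (x + axis i h)) (at 0)"

definition laplacian :: "(real^2 \<Rightarrow> 'b::real_normed_vector) \<Rightarrow> real^2 \<Rightarrow> 'b" where
  "laplacian f x = (\<Sum>i\<in>UNIV. partial_deriv i (partial_deriv i f) x)"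

definition frequency :: "int^2 \<Rightarrow> real^2" where
  "frequency n = (\<chi> i. of_int (n $ i))"

definition fourier_coeff :: "(real^2 \<Rightarrow> complex) \<Rightarrow> int^2 \<Rightarrow> complex" where
  "fourier_coeff f n =
     (LINT x : cbox 0 (\<chi> i. 2 * pi) | lborel. cis (- (frequency n \<bullet> x)) * f x)
       / of_real ((2 * pi)\<^sup>2)"

text \<open>
  The sum converges for every smooth periodic function; where it diverges, \<open>infsum\<close> is
  \<open>0\<close> and the value below is meaningless.
\<close>

definition sobolev_norm :: "real \<Rightarrow> (real^2 \<Rightarrow> complex) \<Rightarrow> real" where
  "sobolev_norm s f =
     sqrt (\<Sum>\<^sub>\<infinity>n\<in>UNIV. (1 + (norm (frequency n))\<^sup>2) powr s * (cmod (fourier_coeff f n))\<^sup>2)"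

end

theory Submission
  imports Defs
begin

text \<open>
  The solution is explicit. In one space variable, \<open>cos a + sin a \<cdot> e\<^sup>i\<^sup>\<theta>\<close> with
  \<open>\<theta> = N x - N\<^sup>2 t\<close> solves the free Schroedinger equation when the mixing angle \<open>a\<close> is constant,
  and it carries the fixed amount \<open>sin\<^sup>2 a\<close> of mass at frequency \<open>N\<close>. If \<open>a\<close> varies slowly in time,
  it still solves a Schroedinger equation after multiplication by \<open>e\<^sup>i\<^sup>\<psi>\<close>, and the potential is
  real exactly when \<open>\<psi>\<close> makes the mass density \<open>\<rho> = 1 + sin 2a \<cdot> cos \<theta>\<close> satisfy the continuity
  equation. For this \<open>\<rho>\<close> that equation integrates in closed form:
  \<open>\<psi> = N\<^sup>-\<^sup>2 a' cos 2a \<cdot> cos \<theta> \<cdot> h (sin 2a \<cdot> cos \<theta>)\<close> with \<open>h z = ln (1 + z) / z\<close>. The angle stays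
  in \<open>[0, 1/2]\<close>, so \<open>\<rho>\<close> never vanishes and both \<open>\<psi>\<close> and the potential are smooth; every term
  of the potential contains a time derivative of \<open>a\<close> (lemma \<open>mode_schrodinger\<close>).

  Let the angle of the \<open>j\<close>-th such mode, with \<open>N = j + 1\<close>, be a fixed smooth bump in the
  logarithmic time \<open>ln (1 + t) - j\<close>. Then \<open>a'\<close> is of size \<open>1 / (1 + t)\<close>, about \<open>e\<^sup>-\<^sup>j\<close>, and
  differentiating the potential in \<open>t\<close> or \<open>x\<close> costs only powers of \<open>j\<close>, so all its derivatives
  tend to \<open>0\<close>. Even and odd modes depend on different coordinates of the torus; hence neighbouring
  modes, which overlap in time, can be multiplied without interacting, and the mode of index
  \<open>j\<close> can be switched off, behind the cover of the next one, before \<open>j + 2\<close> is switched on along the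
  same axis. At every time \<open>t\<close> some mode with \<open>j\<close> close to \<open>ln t\<close> carries a fixed amount of mass at
  frequency \<open>j + 1 \<ge> ln t\<close>, which gives \<open>\<parallel>u(t)\<parallel> \<ge> c (ln t)\<^sup>s\<close> in \<open>H\<^sup>s\<close>.

  Smoothness and decay are both obtained from the notion of a tame family, which is closed
  under the operations that build the modes. Bounds on derivatives become bounds on Sobolev
  norms through the decay of Fourier coefficients (lemma \<open>tame_sobolev\<close>).
\<close>

section \<open>Families of functions with controlled derivatives\<close>

abbreviation cylinder :: "(real \<times> (real^2)) set" where
  "cylinder \<equiv> {0..} \<times> UNIV"

text \<open>
  Boundary points have a unique derivative because the cylinder still contains a short segment in
  each coordinate direction.
\<close>

lemma frechet_derivative_unique_cylinder:
  fixes f :: "real \<times> (real^2) \<Rightarrow> 'b::real_normed_vector"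
  assumes "(f has_derivative f') (at z within cylinder)"
    and "(f has_derivative f'') (at z within cylinder)" and "z \<in> cylinder"
  shows "f' = f''"
proof (rule frechet_derivative_unique_within[OF assms(1,2)])
  fix i :: "real \<times> (real^2)" and e :: real assume i: "i \<in> Basis" and e: "e > 0"
  have "fst i \<ge> 0" using i by (auto simp: Basis_prod_def)
  then show "\<exists>d. 0 < \<bar>d\<bar> \<and> \<bar>d\<bar> < e \<and> z + d *\<^sub>R i \<in> cylinder"
    using e assms(3) by (intro exI[of _ "e/2"]) (auto simp: mem_Times_iff)
qed

text \<open>
  A family \<open>v 0, v 1, \<dots>\<close> is tame of order \<open>k\<close> and weight \<open>w\<close> when its members are spatially
  periodic and all their derivatives up to order \<open>k\<close> grow at most polynomially in the index \<open>j\<close>,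
  relative to \<open>w j\<close>. The recursion mirrors that of \<^const>\<open>Ck_on\<close>, so that smoothness and
  quantitative bounds propagate through the same closure properties.
\<close>

fun tame :: "nat \<Rightarrow> (nat \<Rightarrow> real) \<Rightarrow> (nat \<Rightarrow> real \<times> (real^2) \<Rightarrow> 'b::real_normed_vector) \<Rightarrow> bool" where
  "tame 0 w v \<longleftrightarrow> (\<forall>j. w j \<ge> 0) \<and> (\<forall>j. continuous_on cylinder (v j)) \<and>
     (\<forall>j. \<forall>t\<ge>0. \<forall>x i. v j (t, x + axis i (2 * pi)) = v j (t, x)) \<and>
     (\<exists>C p. \<forall>j. \<forall>z\<in>cylinder. norm (v j z) \<le> C * (1 + real j) ^ p * w j)"
| "tame (Suc k) w v \<longleftrightarrow> tame 0 w v \<and>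
     (\<exists>D. (\<forall>j. \<forall>z\<in>cylinder. (v j has_derivative D j z) (at z within cylinder)) \<and>
          (\<forall>e. tame k w (\<lambda>j z. D j z e)))"

lemma tame_0: "tame k w v \<Longrightarrow> tame 0 w v"
  by (cases k) simp_all

declare tame.simps [simp del]

lemma tame_SucI:
  assumes "tame 0 w v"
    and "\<And>j z. z \<in> cylinder \<Longrightarrow> (v j has_derivative D j z) (at z within cylinder)"
    and "\<And>e. tame k w (\<lambda>j z. D j z e)"
  shows "tame (Suc k) w v"
  using assms unfolding tame.simps(2) by blast

lemma tame_SucE:
  assumes "tame (Suc k) w v"
  obtains D where "\<And>j z. z \<in> cylinder \<Longrightarrow> (v j has_derivative D j z) (at z within cylinder)"
    and "\<And>e. tame k w (\<lambda>j z. D j z e)"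
  using assms unfolding tame.simps(2) by blast

lemma tame_SucD: "tame (Suc k) w v \<Longrightarrow> tame k w v"
proof (induction k arbitrary: v)
  case 0
  then show ?case by (rule tame_0)
next
  case (Suc k)
  obtain D where D: "\<And>j z. z \<in> cylinder \<Longrightarrow> (v j has_derivative D j z) (at z within cylinder)"
    "\<And>e. tame (Suc k) w (\<lambda>j z. D j z e)" using tame_SucE[OF Suc.prems] by blast
  show ?case
    by (rule tame_SucI[OF tame_0[OF Suc.prems] D(1)]) (auto intro: Suc.IH D(2))
qed

lemma tame_bound:
  assumes "tame k w v"
  obtains C p where "C \<ge> 0" "\<And>j z. z \<in> cylinder \<Longrightarrow> norm (v j z) \<le> C * (1 + real j) ^ p * w j"
proof -
  obtain C p where C: "\<And>j z. z \<in> cylinder \<Longrightarrow> norm (v j z) \<le> C * (1 + real j) ^ p * w j"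
    and w: "\<And>j. w j \<ge> 0"
    using tame_0[OF assms] unfolding tame.simps by blast
  show ?thesis
  proof (rule that[of "\<bar>C\<bar>" p])
    fix j and z :: "real \<times> (real^2)" assume z: "z \<in> cylinder"
    have "C * (1 + real j) ^ p * w j \<le> \<bar>C\<bar> * (1 + real j) ^ p * w j"
      using w by (intro mult_right_mono) auto
    then show "norm (v j z) \<le> \<bar>C\<bar> * (1 + real j) ^ p * w j"
      using C[OF z, of j] by linarith
  qed simp
qed

lemma tame_weight_nonneg: "tame k w v \<Longrightarrow> w j \<ge> 0"
  using tame_0 tame.simps(1) by blast

lemma tame_continuous: "tame k w v \<Longrightarrow> continuous_on cylinder (v j)"
  using tame_0 tame.simps(1) by blast

lemma tame_periodic: "tame k w v \<Longrightarrow> t \<ge> 0 \<Longrightarrow> v j (t, x + axis i (2 * pi)) = v j (t, x)"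
  using tame_0 tame.simps(1) by blast

lemma tame_0I:
  assumes "\<And>j. continuous_on cylinder (v j)"
    and "\<And>j t x i. t \<ge> 0 \<Longrightarrow> v j (t, x + axis i (2 * pi)) = v j (t, x)"
    and "\<And>j z. z \<in> cylinder \<Longrightarrow> norm (v j z) \<le> C * (1 + real j) ^ p * w j" and "\<And>j. w j \<ge> 0"
  shows "tame 0 w v"
  using assms unfolding tame.simps by blast

lemma tame_cong:
  assumes "\<And>j z. z \<in> cylinder \<Longrightarrow> v j z = v' j z" "tame k w v"
  shows "tame k w v'"
  using assms
proof (induction k arbitrary: v v')
  case 0
  obtain C p where "C \<ge> 0"
    and C: "\<And>j z. z \<in> cylinder \<Longrightarrow> norm (v j z) \<le> C * (1 + real j) ^ p * w j"
    using tame_bound[OF 0(2)] by blast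
  show ?case
  proof (rule tame_0I)
    show "continuous_on cylinder (v' j)" for j
      using tame_continuous[OF 0(2), of j] 0(1)
        continuous_on_cong[of cylinder cylinder "v j" "v' j"] by auto
    show "v' j (t, x + axis i (2 * pi)) = v' j (t, x)" if "t \<ge> 0" for j t x i
      using tame_periodic[OF 0(2) that, of j x i] 0(1) that by simp
    show "norm (v' j z) \<le> C * (1 + real j) ^ p * w j" if "z \<in> cylinder" for j z
      using 0(1) C that by metis
  qed (use 0 tame_weight_nonneg in blast)
next
  case (Suc k)
  obtain D where D: "\<And>j z. z \<in> cylinder \<Longrightarrow> (v j has_derivative D j z) (at z within cylinder)"
    "\<And>e. tame k w (\<lambda>j z. D j z e)" using tame_SucE[OF Suc.prems(2)] by blast
  show ?case
  proof (rule tame_SucI)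
    have "tame k w v'" by (rule Suc.IH[OF Suc.prems(1) tame_SucD[OF Suc.prems(2)]])
    then show "tame 0 w v'" by (rule tame_0)
    show "(v' j has_derivative D j z) (at z within cylinder)" if "z \<in> cylinder" for j z
      by (rule has_derivative_transform[OF that Suc.prems(1)[symmetric] D(1)[OF that]])
  qed (rule D(2))
qed

text \<open>
  Passing to a larger weight and shifting the index both cost only a factor that is polynomial
  in the index.
\<close>

lemma tame_reindex:
  assumes "tame k w v" and "\<And>j. \<bar>w (j + m)\<bar> \<le> c * w' j" and "\<And>j. w' j \<ge> 0"
  shows "tame k w' (\<lambda>j. v (j + m))"
  using assms(1)
proof (induction k arbitrary: v)
  case 0
  obtain C p where C: "C \<ge> 0" "\<And>j z. z \<in> cylinder \<Longrightarrow> norm (v j z) \<le> C * (1 + real j) ^ p * w j"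
    using tame_bound[OF 0] by blast
  show ?case
  proof (rule tame_0I)
    show "norm (v (j + m) z) \<le> (C * (1 + real m) ^ p * c) * (1 + real j) ^ p * w' j"
      if "z \<in> cylinder" for j z
    proof -
      have "norm (v (j + m) z) \<le> C * (1 + real (j + m)) ^ p * w (j + m)" by (rule C(2)[OF that])
      also have "\<dots> \<le> C * (1 + real (j + m)) ^ p * (c * w' j)"
        using C(1) assms(2)[of j] by (intro mult_left_mono) auto
      also have "\<dots> \<le> C * ((1 + real m) * (1 + real j)) ^ p * (c * w' j)"
      proof (intro mult_right_mono mult_left_mono power_mono)
        show "0 \<le> c * w' j" using assms(2)[of j] by linarith
      qed (use C(1) in \<open>auto simp: algebra_simps\<close>)
      finally show ?thesis by (simp add: power_mult_distrib mult_ac)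
    qed
  qed (use tame_continuous[OF 0] tame_periodic[OF 0] assms(3) in auto)
next
  case (Suc k)
  obtain D where D: "\<And>j z. z \<in> cylinder \<Longrightarrow> (v j has_derivative D j z) (at z within cylinder)"
    "\<And>e. tame k w (\<lambda>j z. D j z e)" using tame_SucE[OF Suc.prems] by blast
  show ?case
    by (rule tame_SucI[where D = "\<lambda>j. D (j + m)"])
      (use Suc.IH D tame_SucD[OF Suc.prems] tame_0 in \<open>blast+\<close>)
qed

lemma tame_weight_mono:
  assumes "tame k w v" and "\<And>j. w j \<le> w' j"
  shows "tame k w' v"
proof -
  have "tame k w' (\<lambda>j. v (j + 0))"
  proof (rule tame_reindex[OF assms(1), where c = 1])
    fix j show "\<bar>w (j + 0)\<bar> \<le> 1 * w' j" "w' j \<ge> 0"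
      using assms(2)[of j] tame_weight_nonneg[OF assms(1), of j] by auto
  qed
  then show ?thesis by simp
qed

lemma tame_add:
  assumes "tame k w f" "tame k w g"
  shows "tame k w (\<lambda>j z. f j z + g j z)"
  using assms
proof (induction k arbitrary: f g)
  case 0
  obtain C p where C: "C \<ge> 0" "\<And>j z. z \<in> cylinder \<Longrightarrow> norm (f j z) \<le> C * (1 + real j) ^ p * w j"
    using tame_bound[OF 0(1)] by blast
  obtain C' p' where C': "C' \<ge> 0" "\<And>j z. z \<in> cylinder \<Longrightarrow> norm (g j z) \<le> C' * (1 + real j) ^ p' * w j"
    using tame_bound[OF 0(2)] by blast
  note w = tame_weight_nonneg[OF 0(1)]
  show ?case
  proof (rule tame_0I)
    show "norm (f j z + g j z) \<le> (C + C') * (1 + real j) ^ (p + p') * w j" if "z \<in> cylinder" for j z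
    proof -
      have "C * (1 + real j) ^ p * w j \<le> C * (1 + real j) ^ (p + p') * w j"
        using C w by (intro mult_right_mono mult_left_mono power_increasing) auto
      moreover have "C' * (1 + real j) ^ p' * w j \<le> C' * (1 + real j) ^ (p + p') * w j"
        using C' w by (intro mult_right_mono mult_left_mono power_increasing) auto
      ultimately show ?thesis
        using norm_triangle_ineq[of "f j z" "g j z"] C(2)[OF that, of j] C'(2)[OF that, of j]
        by (simp add: algebra_simps)
    qed
  qed (use tame_continuous[OF 0(1)] tame_continuous[OF 0(2)] tame_periodic[OF 0(1)]
      tame_periodic[OF 0(2)] w in \<open>auto intro: continuous_on_add\<close>)
next
  case (Suc k)
  obtain D where D: "\<And>j z. z \<in> cylinder \<Longrightarrow> (f j has_derivative D j z) (at z within cylinder)"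
    "\<And>e. tame k w (\<lambda>j z. D j z e)" using tame_SucE[OF Suc.prems(1)] by blast
  obtain D' where D': "\<And>j z. z \<in> cylinder \<Longrightarrow> (g j has_derivative D' j z) (at z within cylinder)"
    "\<And>e. tame k w (\<lambda>j z. D' j z e)" using tame_SucE[OF Suc.prems(2)] by blast
  show ?case
  proof (rule tame_SucI)
    show "tame 0 w (\<lambda>j z. f j z + g j z)"
      using Suc.IH[OF Suc.prems[THEN tame_SucD]] by (rule tame_0)
    show "((\<lambda>z. f j z + g j z) has_derivative (\<lambda>e. D j z e + D' j z e)) (at z within cylinder)"
      if "z \<in> cylinder" for j z
      using D(1)[OF that] D'(1)[OF that] by (rule has_derivative_add)
    show "tame k w (\<lambda>j z. D j z e + D' j z e)" for e
      using D(2) D'(2) by (rule Suc.IH)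
  qed
qed

lemma tame_bilinear:
  assumes "bounded_bilinear B" "tame k w f" "tame k w' g"
  shows "tame k (\<lambda>j. w j * w' j) (\<lambda>j z. B (f j z) (g j z))"
  using assms(2,3)
proof (induction k arbitrary: f g)
  case 0
  obtain C p where C: "C \<ge> 0" "\<And>j z. z \<in> cylinder \<Longrightarrow> norm (f j z) \<le> C * (1 + real j) ^ p * w j"
    using tame_bound[OF 0(1)] by blast
  obtain C' p' where C': "C' \<ge> 0" "\<And>j z. z \<in> cylinder \<Longrightarrow> norm (g j z) \<le> C' * (1 + real j) ^ p' * w' j"
    using tame_bound[OF 0(2)] by blast
  note w = tame_weight_nonneg[OF 0(1)] tame_weight_nonneg[OF 0(2)]
  obtain K where K: "K \<ge> 0" "\<And>a b. norm (B a b) \<le> norm a * norm b * K"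
    using bounded_bilinear.nonneg_bounded[OF assms(1)] by blast
  show ?case
  proof (rule tame_0I)
    show "norm (B (f j z) (g j z)) \<le> (K * C * C') * (1 + real j) ^ (p + p') * (w j * w' j)"
      if "z \<in> cylinder" for j z
    proof -
      have "norm (B (f j z) (g j z)) \<le> norm (f j z) * norm (g j z) * K" by (rule K)
      also have "\<dots> \<le> (C * (1 + real j) ^ p * w j) * (C' * (1 + real j) ^ p' * w' j) * K"
        using C(2)[OF that] C'(2)[OF that] K(1) C(1) C'(1) w
        by (intro mult_right_mono mult_mono) auto
      finally show ?thesis by (simp add: power_add mult_ac)
    qed
  qed (use tame_continuous[OF 0(1)] tame_continuous[OF 0(2)] tame_periodic[OF 0(1)]
      tame_periodic[OF 0(2)] w in \<open>auto intro: bounded_bilinear.continuous_on[OF assms(1)]\<close>)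
next
  case (Suc k)
  obtain D where D: "\<And>j z. z \<in> cylinder \<Longrightarrow> (f j has_derivative D j z) (at z within cylinder)"
    "\<And>e. tame k w (\<lambda>j z. D j z e)" using tame_SucE[OF Suc.prems(1)] by blast
  obtain D' where D': "\<And>j z. z \<in> cylinder \<Longrightarrow> (g j has_derivative D' j z) (at z within cylinder)"
    "\<And>e. tame k w' (\<lambda>j z. D' j z e)" using tame_SucE[OF Suc.prems(2)] by blast
  note s = Suc.prems[THEN tame_SucD]
  show ?case
  proof (rule tame_SucI)
    show "tame 0 (\<lambda>j. w j * w' j) (\<lambda>j z. B (f j z) (g j z))"
      using Suc.IH[OF s] by (rule tame_0)
    show "((\<lambda>z. B (f j z) (g j z)) has_derivative
        (\<lambda>e. B (f j z) (D' j z e) + B (D j z e) (g j z))) (at z within cylinder)"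
      if "z \<in> cylinder" for j z
      using D(1)[OF that] D'(1)[OF that] by (rule bounded_bilinear.FDERIV[OF assms(1)])
    show "tame k (\<lambda>j. w j * w' j) (\<lambda>j z. B (f j z) (D' j z e) + B (D j z e) (g j z))" for e
      by (intro tame_add Suc.IH s D D')
  qed
qed

lemma tame_linear:
  assumes "bounded_linear L" "tame k w f"
  shows "tame k w (\<lambda>j z. L (f j z))"
  using assms(2)
proof (induction k arbitrary: f)
  case 0
  obtain C p where C: "C \<ge> 0" "\<And>j z. z \<in> cylinder \<Longrightarrow> norm (f j z) \<le> C * (1 + real j) ^ p * w j"
    using tame_bound[OF 0(1)] by blast
  obtain K where K: "K \<ge> 0" "\<And>a. norm (L a) \<le> norm a * K"
    using bounded_linear.nonneg_bounded[OF assms(1)] by blast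
  show ?case
  proof (rule tame_0I)
    show "norm (L (f j z)) \<le> (C * K) * (1 + real j) ^ p * w j" if "z \<in> cylinder" for j z
      using order_trans[OF K(2) mult_right_mono[OF C(2)[OF that] K(1)]] by (simp add: mult_ac)
  qed (use tame_continuous[OF 0] tame_periodic[OF 0] tame_weight_nonneg[OF 0]
      in \<open>auto intro: bounded_linear.continuous_on[OF assms(1)]\<close>)
next
  case (Suc k)
  obtain D where D: "\<And>j z. z \<in> cylinder \<Longrightarrow> (f j has_derivative D j z) (at z within cylinder)"
    "\<And>e. tame k w (\<lambda>j z. D j z e)" using tame_SucE[OF Suc.prems] by blast
  show ?case
  proof (rule tame_SucI)
    show "tame 0 w (\<lambda>j z. L (f j z))"
      using Suc.IH[OF tame_SucD[OF Suc.prems]] by (rule tame_0)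
    show "((\<lambda>z. L (f j z)) has_derivative (\<lambda>e. L (D j z e))) (at z within cylinder)"
      if "z \<in> cylinder" for j z
      using D(1)[OF that] by (rule bounded_linear.has_derivative[OF assms(1)])
  qed (intro Suc.IH D)
qed

lemma tame_mult:
  fixes f g :: "nat \<Rightarrow> real \<times> (real^2) \<Rightarrow> 'b::real_normed_algebra"
  assumes "tame k (\<lambda>_. 1) f" "tame k w g"
  shows "tame k w (\<lambda>j z. f j z * g j z)" "tame k w (\<lambda>j z. g j z * f j z)"
  using tame_bilinear[OF bounded_bilinear_mult assms]
    tame_bilinear[OF bounded_bilinear_mult assms(2,1)] by simp_all

lemma tame_uminus: "tame k w f \<Longrightarrow> tame k w (\<lambda>j z. - f j z)"
  by (rule tame_linear[OF bounded_linear_minus[OF bounded_linear_ident]])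

lemma tame_diff:
  assumes "tame k w f" "tame k w g"
  shows "tame k w (\<lambda>j z. f j z - g j z)"
  using tame_add[OF assms(1) tame_uminus[OF assms(2)]] by simp

lemma tame_of_real:
  fixes f :: "nat \<Rightarrow> real \<times> (real^2) \<Rightarrow> real"
  shows "tame k w f \<Longrightarrow> tame k w (\<lambda>j z. complex_of_real (f j z))"
  by (rule tame_linear[OF bounded_linear_of_real])

text \<open>
  This admits the frequency \<open>j + 1\<close> of the \<open>j\<close>-th mode as a tame coefficient, which is why the
  bounds have to allow polynomial growth.
\<close>

lemma tame_index:
  assumes "\<And>j. norm (c j) \<le> C * (1 + real j) ^ p * w j" "\<And>j. w j \<ge> 0"
  shows "tame k w (\<lambda>j z. c j)"
proof (induction k)
  case 0
  show ?case by (rule tame_0I[where C = C and p = p]) (use assms in auto)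
next
  case (Suc k)
  have "tame k' w (\<lambda>j z. 0::'a)" for k'
  proof (induction k')
    case 0
    show ?case by (rule tame_0I[where C = 0 and p = 0]) (use assms in auto)
  next
    case (Suc k')
    show ?case by (rule tame_SucI[OF tame_0[OF Suc]]) (auto intro: Suc)
  qed
  then show ?case by (intro tame_SucI[OF tame_0[OF Suc], where D = "\<lambda>j z e. 0"]) auto
qed

lemma tame_const: "tame k (\<lambda>_. 1) (\<lambda>j z. c)"
  by (rule tame_index[where C = "norm c" and p = 0]) auto

text \<open>
  The outer function is given together with all its derivatives \<open>G n\<close>, so that the chain rule stays
  within the statement and induction on the order applies.
\<close>

lemma tame_compose:
  fixes f :: "nat \<Rightarrow> real \<times> (real^2) \<Rightarrow> real" and G :: "nat \<Rightarrow> real \<Rightarrow> real"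
  assumes "tame k (\<lambda>_. 1) f" and "\<And>j z. z \<in> cylinder \<Longrightarrow> f j z \<in> K"
    and "\<And>n y. y \<in> K \<Longrightarrow> (G n has_real_derivative G (Suc n) y) (at y)"
    and "\<And>n. bounded (G n ` K)"
  shows "tame k (\<lambda>_. 1) (\<lambda>j z. G n (f j z))"
  using assms(1)
proof (induction k arbitrary: n)
  case 0
  obtain C where C: "\<And>y. y \<in> K \<Longrightarrow> norm (G n y) \<le> C"
    using assms(4)[of n] by (auto simp: bounded_iff)
  show ?case
  proof (rule tame_0I)
    show "continuous_on cylinder (\<lambda>z. G n (f j z))" for j
    proof (rule continuous_on_compose2[of K "G n"])
      show "continuous_on K (G n)"
        by (rule DERIV_continuous_on[OF DERIV_subset[OF assms(3)]]) auto
    qed (use tame_continuous[OF 0] assms(2) in auto)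
    show "norm (G n (f j z)) \<le> C * (1 + real j) ^ 0 * 1" if "z \<in> cylinder" for j z
      using C assms(2)[OF that] by simp
  qed (use tame_periodic[OF 0] in auto)
next
  case (Suc k)
  obtain D where D: "\<And>j z. z \<in> cylinder \<Longrightarrow> (f j has_derivative D j z) (at z within cylinder)"
    "\<And>e. tame k (\<lambda>_. 1) (\<lambda>j z. D j z e)" using tame_SucE[OF Suc.prems] by blast
  note IH = Suc.IH[OF tame_SucD[OF Suc.prems]]
  show ?case
  proof (rule tame_SucI)
    show "tame 0 (\<lambda>_. 1) (\<lambda>j z. G n (f j z))" using IH by (rule tame_0)
    show "((\<lambda>z. G n (f j z)) has_derivative (\<lambda>e. D j z e * G (Suc n) (f j z))) (at z within cylinder)"
      if "z \<in> cylinder" for j z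
      using has_derivative_compose[OF D(1)[OF that]
        assms(3)[OF assms(2)[OF that], unfolded has_field_derivative_def]]
      by (simp add: mult.commute)
    show "tame k (\<lambda>_. 1) (\<lambda>j z. D j z e * G (Suc n) (f j z))" for e
      by (intro tame_mult D IH)
  qed
qed


definition tame_smooth :: "(nat \<Rightarrow> real) \<Rightarrow> (nat \<Rightarrow> real \<times> (real^2) \<Rightarrow> 'b::real_normed_vector) \<Rightarrow> bool" where
  "tame_smooth w v \<longleftrightarrow> (\<forall>k. tame k w v)"

definition directional_deriv ::
    "real \<times> (real^2) \<Rightarrow> (nat \<Rightarrow> real \<times> (real^2) \<Rightarrow> 'b) \<Rightarrow> nat \<Rightarrow> real \<times> (real^2) \<Rightarrow> 'b::real_normed_vector" where
  "directional_deriv e v j z = frechet_derivative (v j) (at z within cylinder) e"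

lemma frechet_derivative_cylinder_eq:
  assumes "(f has_derivative f') (at z within cylinder)" "z \<in> cylinder"
  shows "frechet_derivative f (at z within cylinder) = f'"
  using assms by (metis frechet_derivative_unique_cylinder frechet_derivative_works differentiableI)

lemma tame_smooth_has_derivative:
  assumes "tame_smooth w v" "z \<in> cylinder"
  shows "(v j has_derivative (\<lambda>e. directional_deriv e v j z)) (at z within cylinder)"
proof -
  have "tame (Suc 0) w v" using assms(1) by (simp add: tame_smooth_def)
  then obtain D where "\<And>j z. z \<in> cylinder \<Longrightarrow> (v j has_derivative D j z) (at z within cylinder)"
    using tame_SucE by blast
  from this[OF assms(2), of j] show ?thesis
    unfolding directional_deriv_def by (metis frechet_derivative_works differentiableI)
qed

lemma tame_smooth_directional_deriv:
  assumes "tame_smooth w v"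
  shows "tame_smooth w (directional_deriv e v)"
  unfolding tame_smooth_def
proof
  fix k
  have "tame (Suc k) w v" using assms by (simp add: tame_smooth_def)
  then obtain D where D: "\<And>j z. z \<in> cylinder \<Longrightarrow> (v j has_derivative D j z) (at z within cylinder)"
    "\<And>e. tame k w (\<lambda>j z. D j z e)" using tame_SucE by blast
  show "tame k w (directional_deriv e v)"
    by (rule tame_cong[OF _ D(2)[of e]])
      (simp add: directional_deriv_def frechet_derivative_cylinder_eq[OF D(1)])
qed

lemma tame_smooth_time_derivative:
  assumes "tame_smooth w v" "t \<ge> 0"
  shows "((\<lambda>\<tau>. v j (\<tau>, x)) has_vector_derivative directional_deriv (1, 0) v j (t, x)) (at t within {0..})"
proof -
  have z: "(t, x) \<in> cylinder" using assms(2) by auto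
  have i: "((\<lambda>\<tau>. (\<tau>, x)) has_derivative (\<lambda>h. (h, 0))) (at t within {0..})"
    by (auto intro!: derivative_eq_intros)
  note D = tame_smooth_has_derivative[OF assms(1) z, of j]
  have *: "(v j has_derivative (\<lambda>e. directional_deriv e v j (t, x))) (at (t, x) within (\<lambda>\<tau>. (\<tau>, x)) ` {0..})"
    by (rule has_derivative_subset[OF D]) auto
  have "linear (\<lambda>e. directional_deriv e v j (t, x))"
    using D by (rule has_derivative_linear)
  then have "h *\<^sub>R directional_deriv (1, 0) v j (t, x) = directional_deriv (h, 0) v j (t, x)" for h
    using linear_scale[of "\<lambda>e. directional_deriv e v j (t, x)" h "(1, 0)"] by simp
  then show ?thesis
    using has_derivative_in_compose[OF i *] by (simp only: has_vector_derivative_def)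
qed

lemma tame_smooth_space_derivative:
  assumes "tame_smooth w v" "t \<ge> 0"
  shows "((\<lambda>h. v j (t, x + axis i h)) has_vector_derivative
    directional_deriv (0, axis i 1) v j (t, x + axis i h)) (at h)"
proof -
  have z: "(t, x + axis i h) \<in> cylinder" using assms(2) by auto
  have ax: "axis i r = r *\<^sub>R (axis i 1 :: real^2)" for r :: real
    by (simp add: vec_eq_iff axis_def)
  have i: "((\<lambda>h. (t, x + axis i h)) has_derivative (\<lambda>h. (0, axis i h))) (at h)"
  proof -
    have "linear (axis i :: real \<Rightarrow> real^2)"
      by (intro linearI) (simp_all add: vec_eq_iff axis_def)
    then have a: "(axis i has_derivative (axis i :: real \<Rightarrow> real^2)) (at h)"
      by (intro bounded_linear_imp_has_derivative) (simp add: linear_conv_bounded_linear)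
    show ?thesis
      by (rule has_derivative_eq_rhs[OF has_derivative_Pair[OF has_derivative_const
            has_derivative_add[OF has_derivative_const a]]]) simp
  qed
  note D = tame_smooth_has_derivative[OF assms(1) z, of j]
  have *: "(v j has_derivative (\<lambda>e. directional_deriv e v j (t, x + axis i h)))
      (at (t, x + axis i h) within range (\<lambda>h. (t, x + axis i h)))"
    by (rule has_derivative_subset[OF D]) (use assms(2) in auto)
  have "linear (\<lambda>e. directional_deriv e v j (t, x + axis i h))"
    using D by (rule has_derivative_linear)
  then have "r *\<^sub>R directional_deriv (0, axis i 1) v j (t, x + axis i h)
      = directional_deriv (0, axis i r) v j (t, x + axis i h)" for r
    using linear_scale[of "\<lambda>e. directional_deriv e v j (t, x + axis i h)" r "(0, axis i 1)"]
    by (simp only: ax[of r] scaleR_Pair scaleR_zero_right)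
  then show ?thesis
    using has_derivative_in_compose[OF i *] by (simp only: has_vector_derivative_def)
qed

lemma at_within_nonneg_nontrivial: "t \<ge> 0 \<Longrightarrow> at t within {0::real..} \<noteq> bot"
proof -
  assume "t \<ge> 0"
  then have "at t within {t..t+1} \<le> at t within {0..}" by (intro at_le) auto
  moreover have "at t within {t..t+1} \<noteq> bot"
    using islimpt_Icc[of t "t+1" t] by (auto simp: trivial_limit_within)
  ultimately show ?thesis by (metis bot.extremum_uniqueI)
qed

lemma time_deriv_eqI:
  assumes "((\<lambda>\<tau>. f \<tau> x) has_vector_derivative y) (at t within {0..})" "t \<ge> 0"
  shows "time_deriv f t x = y"
  unfolding time_deriv_def
  by (rule vector_derivative_within[OF at_within_nonneg_nontrivial[OF assms(2)] assms(1)])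

lemma tame_smooth_Ck_on:
  assumes "tame_smooth w v"
  shows "Ck_on k (v j) cylinder"
  using assms
proof (induction k arbitrary: v)
  case 0
  then show ?case using tame_continuous[of 0 w v j] unfolding tame_smooth_def by simp
next
  case (Suc k)
  have "v j differentiable_on cylinder"
    unfolding differentiable_on_def
    using tame_smooth_has_derivative[OF Suc.prems] by (blast intro: differentiableI)
  moreover have "Ck_on k (directional_deriv e v j) cylinder" for e
    by (intro Suc tame_smooth_directional_deriv)
  ultimately show ?case
    by (simp add: directional_deriv_def[abs_def])
qed

text \<open>
  Since \<^const>\<open>Ck_on\<close> refers to derivatives within the cylinder only through germs, it can be checked
  on a relatively open cover.
\<close>

lemma Ck_on_glue:
  fixes f :: "real \<times> (real^2) \<Rightarrow> 'b::real_normed_vector"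
  assumes "\<And>m k. Ck_on k (g m) cylinder" and "\<And>m. open (U m)" and "cylinder \<subseteq> (\<Union>m. U m)"
    and "\<And>m z. z \<in> cylinder \<Longrightarrow> z \<in> U m \<Longrightarrow> f z = g m z"
  shows "Ck_on k f cylinder"
  using assms(1,4)
proof (induction k arbitrary: f g)
  case 0
  have "continuous (at z within cylinder) f" if z: "z \<in> cylinder" for z
  proof -
    obtain m where m: "z \<in> U m" using assms(3) z by auto
    have "continuous (at z within cylinder) (g m)"
      using 0(1)[of 0 m] z unfolding Ck_on.simps continuous_on_eq_continuous_within by blast
    moreover have "\<forall>\<^sub>F y in at z within cylinder. g m y = f y"
      unfolding eventually_at_topological using 0(2) assms(2)[of m] m by metis
    ultimately show ?thesis
      unfolding continuous_within using 0(2)[OF z m] Lim_transform_eventually by force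
  qed
  then show ?case unfolding Ck_on.simps continuous_on_eq_continuous_within by blast
next
  case (Suc k)
  have d: "(f has_derivative frechet_derivative (g m) (at z within cylinder)) (at z within cylinder)"
    if z: "z \<in> cylinder" "z \<in> U m" for z m
  proof -
    have "g m differentiable (at z within cylinder)"
      using Suc.prems(1)[of "Suc 0" m] z unfolding Ck_on.simps differentiable_on_def by blast
    then have "(g m has_derivative frechet_derivative (g m) (at z within cylinder)) (at z within cylinder)"
      by (simp add: frechet_derivative_works)
    moreover have "\<forall>\<^sub>F y in at z within cylinder. g m y = f y"
      unfolding eventually_at_topological using Suc.prems(2) assms(2)[of m] z by metis
    ultimately show ?thesis
      by (rule has_derivative_transform_eventually) (simp_all add: Suc.prems(2)[OF z] z)
  qed
  show ?case unfolding Ck_on.simps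
  proof (intro conjI allI)
    show "f differentiable_on cylinder"
      unfolding differentiable_on_def using d assms(3) by (blast intro: differentiableI)
    fix v
    show "Ck_on k (\<lambda>z. frechet_derivative f (at z within cylinder) v) cylinder"
    proof (rule Suc.IH[where g = "\<lambda>m z. frechet_derivative (g m) (at z within cylinder) v"])
      show "Ck_on k (\<lambda>z. frechet_derivative (g m) (at z within cylinder) v) cylinder" for k m
        using Suc.prems(1)[of "Suc k" m] unfolding Ck_on.simps by blast
      show "frechet_derivative f (at z within cylinder) v
          = frechet_derivative (g m) (at z within cylinder) v"
        if "z \<in> cylinder" "z \<in> U m" for m z
        using frechet_derivative_cylinder_eq[OF d[OF that] that(1)] by simp
    qed
  qed
qed

section \<open>Fourier coefficients of smooth periodic functions\<close>

lemma two_neq_add_one: "(i::2) \<noteq> i + 1"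
  by simp

lemma UNIV_2_split: "(UNIV :: 2 set) = {i, i + 1}"
proof -
  have "card {i, i + 1} = card (UNIV :: 2 set)" using two_neq_add_one[of i] by simp
  then show ?thesis by (metis card_subset_eq finite subset_UNIV)
qed

text \<open>
  Listing coordinate \<open>i\<close> first identifies \<open>\<real> \<times> \<real>\<close> with \<open>\<real>\<^sup>2\<close>; since this preserves
  Lebesgue measure, Fubini's theorem allows integrating over coordinate \<open>i\<close> before the other one.
\<close>

definition pairing :: "2 \<Rightarrow> real \<times> real \<Rightarrow> real^2" where
  "pairing i p = axis i (fst p) + axis (i + 1) (snd p)"

lemma pairing_nth: "pairing i p $ i = fst p" "pairing i p $ (i + 1) = snd p"
  using two_neq_add_one[of i] by (auto simp: pairing_def axis_def)

lemma continuous_pairing: "continuous_on UNIV (pairing i)"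
proof -
  have "linear (pairing i)"
    by (intro linearI) (simp_all add: vec_eq_iff axis_def pairing_def algebra_simps)
  then show ?thesis by (simp add: linear_continuous_on linear_conv_bounded_linear)
qed

lemma distr_pairing: "distr lborel borel (pairing i) = (lborel :: (real^2) measure)"
proof (rule lborel_eqI[symmetric])
  fix l u :: "real^2" assume lu: "\<And>b. b \<in> Basis \<Longrightarrow> l \<bullet> b \<le> u \<bullet> b"
  have meas: "pairing i \<in> borel \<rightarrow>\<^sub>M borel"
    using continuous_pairing by (rule borel_measurable_continuous_onI)
  have B: "(Basis :: (real^2) set) = {axis i 1, axis (i + 1) 1}"
    unfolding Basis_vec_def UNIV_2_split[of i] by auto
  have ne: "axis i (1::real) \<noteq> axis (i + 1) 1"
    using two_neq_add_one[of i] by (simp add: axis_eq_axis)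
  have le: "l $ i \<le> u $ i" "l $ (i + 1) \<le> u $ (i + 1)"
    using lu[of "axis i 1"] lu[of "axis (i + 1) 1"] unfolding B by (simp_all add: inner_axis)
  have "pairing i -` box l u = box (l $ i, l $ (i + 1)) (u $ i, u $ (i + 1))"
    by (auto simp: mem_box B inner_axis Basis_prod_def pairing_nth)
  then have "emeasure (distr lborel borel (pairing i)) (box l u)
      = emeasure lborel (box (l $ i, l $ (i + 1)) (u $ i, u $ (i + 1)))"
    using meas by (simp add: emeasure_distr)
  also have "\<dots> = (u $ i - l $ i) * (u $ (i + 1) - l $ (i + 1))"
    using le by (subst emeasure_lborel_box) (auto simp: Basis_prod_def)
  also have "\<dots> = (\<Prod>b\<in>Basis. (u - l) \<bullet> b)"
    unfolding B using ne by (simp add: inner_axis)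
  finally show "emeasure (distr lborel borel (pairing i)) (box l u) = (\<Prod>b\<in>Basis. (u - l) \<bullet> b)" .
qed simp

abbreviation period_cell :: "(real^2) set" where
  "period_cell \<equiv> cbox 0 (\<chi> i. 2 * pi)"

lemma mem_period_cell: "x \<in> period_cell \<longleftrightarrow> (\<forall>i. x $ i \<in> {0..2 * pi})"
  by (simp add: mem_box_cart)

lemma set_integrable_period_cell:
  fixes f :: "real^2 \<Rightarrow> complex"
  shows "continuous_on UNIV f \<Longrightarrow> set_integrable lborel period_cell f"
  unfolding set_integrable_def
  by (rule borel_integrable_compact[OF compact_cbox]) (rule continuous_on_subset, auto)

text \<open>
  By Fubini's theorem and the fundamental theorem of calculus: integrating first over coordinate
  \<open>i\<close> gives the difference of the values at the two ends of a period.
\<close>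

lemma integral_period_cell_derivative:
  fixes g g' :: "real^2 \<Rightarrow> complex"
  assumes cont: "continuous_on UNIV g'"
    and deriv: "\<And>x h. ((\<lambda>h. g (x + axis i h)) has_vector_derivative g' (x + axis i h)) (at h)"
    and per: "\<And>x. g (x + axis i (2 * pi)) = g x"
  shows "(LINT x:period_cell|lborel. g' x) = 0"
proof -
  let ?I = "indicator {0..2 * pi} :: real \<Rightarrow> real"
  have meas: "pairing i \<in> borel \<rightarrow>\<^sub>M borel"
    using continuous_pairing by (rule borel_measurable_continuous_onI)
  have intg: "integrable lborel (\<lambda>x. indicator period_cell x *\<^sub>R g' x)"
    using set_integrable_period_cell[OF cont] by (simp add: set_integrable_def)
  have ind: "indicator period_cell (pairing i (y, z)) = ?I y * ?I z" for y z
  proof -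
    have "pairing i (y, z) \<in> period_cell \<longleftrightarrow> y \<in> {0..2 * pi} \<and> z \<in> {0..2 * pi}"
    proof -
      have "(\<forall>k. pairing i (y, z) $ k \<in> {0..2 * pi}) \<longleftrightarrow> (\<forall>k\<in>{i, i+1}. pairing i (y, z) $ k \<in> {0..2 * pi})"
        using UNIV_2_split[of i] by (metis UNIV_I)
      then show ?thesis unfolding mem_period_cell by (simp add: pairing_nth)
    qed
    then show ?thesis by (simp add: indicator_def)
  qed
  have "(LINT x:period_cell|lborel. g' x) = (\<integral>x. indicator period_cell x *\<^sub>R g' x \<partial>distr lborel borel (pairing i))"
    by (simp add: set_lebesgue_integral_def distr_pairing)
  also have "\<dots> = (\<integral>p. indicator period_cell (pairing i p) *\<^sub>R g' (pairing i p) \<partial>lborel)"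
  proof (rule integral_distr)
    show "(\<lambda>x. indicator period_cell x *\<^sub>R g' x) \<in> borel_measurable borel"
      using borel_measurable_integrable[OF intg] by simp
  qed (use meas in simp)
  also have "\<dots> = (\<integral>p. (\<lambda>(y, z). indicator period_cell (pairing i (y, z)) *\<^sub>R g' (pairing i (y, z))) p
      \<partial>(lborel \<Otimes>\<^sub>M lborel))"
    by (simp add: lborel_prod case_prod_beta)
  also have "\<dots> = (\<integral>z. (\<integral>y. indicator period_cell (pairing i (y, z)) *\<^sub>R g' (pairing i (y, z)) \<partial>lborel) \<partial>lborel)"
  proof (rule lborel_pair.integral_snd[symmetric])
    have "integrable (distr lborel borel (pairing i)) (\<lambda>x. indicator period_cell x *\<^sub>R g' x)"
      using intg by (simp add: distr_pairing)
    then have "integrable lborel (\<lambda>p. indicator period_cell (pairing i p) *\<^sub>R g' (pairing i p))"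
      by (rule integrable_distr[rotated]) (use meas in simp)
    then show "integrable (lborel \<Otimes>\<^sub>M lborel)
        (\<lambda>(y, z). indicator period_cell (pairing i (y, z)) *\<^sub>R g' (pairing i (y, z)))"
      by (simp add: lborel_prod case_prod_unfold)
  qed
  also have "\<dots> = (\<integral>z. 0 \<partial>(lborel :: real measure))"
  proof (rule Bochner_Integration.integral_cong[OF refl])
    fix z :: real
    have "(\<integral>y. ?I y *\<^sub>R g' (pairing i (y, z)) \<partial>lborel) = g (pairing i (2 * pi, z)) - g (pairing i (0, z))"
    proof (rule integral_FTC_atLeastAtMost)
      have eq: "pairing i (y, z) = axis (i + 1) z + axis i y" for y by (simp add: pairing_def)
      show "((\<lambda>y. g (pairing i (y, z))) has_vector_derivative g' (pairing i (y, z))) (at y within {0..2 * pi})" for y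
        unfolding eq using deriv by (rule has_vector_derivative_at_within)
      show "continuous_on {0..2 * pi} (\<lambda>y. g' (pairing i (y, z)))"
        by (intro continuous_on_compose2[OF cont] continuous_on_compose2[OF continuous_pairing]
            continuous_intros) auto
    qed simp
    also have "pairing i (2 * pi, z) = pairing i (0, z) + axis i (2 * pi)"
      by (simp add: pairing_def vec_eq_iff axis_def)
    finally have "(\<integral>y. ?I y *\<^sub>R g' (pairing i (y, z)) \<partial>lborel) = 0" by (simp add: per)
    then have "?I z *\<^sub>R (\<integral>y. ?I y *\<^sub>R g' (pairing i (y, z)) \<partial>lborel) = 0" by simp
    then show "(\<integral>y. indicator period_cell (pairing i (y, z)) *\<^sub>R g' (pairing i (y, z)) \<partial>lborel) = 0"
      unfolding ind integral_scaleR_right[symmetric] by (simp add: mult.commute)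
  qed
  finally show ?thesis by simp
qed

lemma frequency_axis: "frequency n \<bullet> axis i h = of_int (n $ i) * h"
  by (simp add: inner_axis frequency_def)

text \<open>
  Integration by parts, as the vanishing of the integral of the derivative of
  \<open>e\<^sup>-\<^sup>i\<^sup>n\<^sup>x f(x)\<close>.
\<close>

lemma fourier_coeff_derivative:
  fixes f f' :: "real^2 \<Rightarrow> complex"
  assumes cont: "continuous_on UNIV f" "continuous_on UNIV f'"
    and deriv: "\<And>x h. ((\<lambda>h. f (x + axis i h)) has_vector_derivative f' (x + axis i h)) (at h)"
    and per: "\<And>x. f (x + axis i (2 * pi)) = f x"
  shows "fourier_coeff f' n = \<i> * of_int (n $ i) * fourier_coeff f n"
proof -
  let ?e = "\<lambda>x. cis (- (frequency n \<bullet> x))"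
  have ce: "continuous_on UNIV ?e" by (intro continuous_intros)
  have "(LINT x:period_cell|lborel. ?e x * f' x - \<i> * of_int (n $ i) * (?e x * f x)) = 0"
  proof (rule integral_period_cell_derivative)
    show "continuous_on UNIV (\<lambda>x. ?e x * f' x - \<i> * of_int (n $ i) * (?e x * f x))"
      by (intro continuous_intros cont)
    show "?e (x + axis i (2 * pi)) * f (x + axis i (2 * pi)) = ?e x * f x" for x
    proof -
      have "- (frequency n \<bullet> (x + axis i (2 * pi))) = - (frequency n \<bullet> x) + 2 * pi * of_int (- (n $ i))"
        by (simp add: inner_add_right frequency_axis)
      then have "?e (x + axis i (2 * pi)) = ?e x * cis (2 * pi * of_int (- (n $ i)))"
        by (simp only: cis_mult)
      moreover have "cis (2 * pi * of_int (- (n $ i))) = 1" by (rule cis_multiple_2pi) simp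
      ultimately show ?thesis by (simp add: per)
    qed
    show "((\<lambda>h. ?e (x + axis i h) * f (x + axis i h)) has_vector_derivative
        ?e (x + axis i h) * f' (x + axis i h) - \<i> * of_int (n $ i) * (?e (x + axis i h) * f (x + axis i h))) (at h)"
      for x h
    proof -
      have "((\<lambda>h. ?e (x + axis i h)) has_vector_derivative
          - (\<i> * of_int (n $ i) * ?e (x + axis i h))) (at h)"
        unfolding inner_add_right frequency_axis cis_conv_exp
        by (auto intro!: derivative_eq_intros has_vector_derivative_real_field simp: algebra_simps)
      from has_vector_derivative_mult[OF this deriv[of x h]] show ?thesis
        by (simp add: algebra_simps)
    qed
  qed
  also have "(LINT x:period_cell|lborel. ?e x * f' x - \<i> * of_int (n $ i) * (?e x * f x))
      = (LINT x:period_cell|lborel. ?e x * f' x) - \<i> * of_int (n $ i) * (LINT x:period_cell|lborel. ?e x * f x)"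
    by (subst set_integral_diff(2)) (auto intro!: set_integrable_period_cell continuous_intros cont)
  finally show ?thesis unfolding fourier_coeff_def by (simp add: field_simps)
qed


lemma measure_period_cell: "measure lborel period_cell = (2 * pi)\<^sup>2"
  by (subst content_cbox_cart) (simp_all add: interval_eq_empty_cart not_less power2_eq_square)

lemma norm_fourier_coeff_le:
  assumes "continuous_on UNIV f" and "\<And>x. cmod (f x) \<le> B"
  shows "cmod (fourier_coeff f n) \<le> B"
proof -
  have int: "set_integrable lborel period_cell (\<lambda>x. cis (- (frequency n \<bullet> x)) * f x)"
    by (intro set_integrable_period_cell continuous_intros assms)
  have "cmod (LINT x:period_cell|lborel. cis (- (frequency n \<bullet> x)) * f x)
      \<le> (LINT x:period_cell|lborel. cmod (cis (- (frequency n \<bullet> x)) * f x))"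
    by (rule set_integral_norm_bound[OF int])
  also have "\<dots> \<le> (LINT x:period_cell|lborel. B)"
  proof (rule set_integral_mono)
    show "set_integrable lborel period_cell (\<lambda>x. cmod (cis (- (frequency n \<bullet> x)) * f x))"
      using int by (rule set_integrable_norm)
    show "set_integrable lborel period_cell (\<lambda>x. B)"
      unfolding set_integrable_def by (rule borel_integrable_compact) auto
  qed (use assms(2) in \<open>simp add: norm_mult\<close>)
  also have "\<dots> = (2 * pi)\<^sup>2 * B"
    by (simp add: set_lebesgue_integral_def measure_period_cell)
  finally show ?thesis
    unfolding fourier_coeff_def norm_divide by (simp add: field_simps norm_mult norm_power)
qed

lemma fourier_coeff_add:
  assumes "continuous_on UNIV f" "continuous_on UNIV g"
  shows "fourier_coeff (\<lambda>x. f x + g x) n = fourier_coeff f n + fourier_coeff g n"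
proof -
  have "(LINT x:period_cell|lborel. cis (- (frequency n \<bullet> x)) * (f x + g x))
      = (LINT x:period_cell|lborel. cis (- (frequency n \<bullet> x)) * f x)
      + (LINT x:period_cell|lborel. cis (- (frequency n \<bullet> x)) * g x)"
    unfolding distrib_left
    by (intro set_integral_add set_integrable_period_cell continuous_intros assms)
  then show ?thesis unfolding fourier_coeff_def by (simp add: add_divide_distrib)
qed

lemma fourier_coeff_cmult: "fourier_coeff (\<lambda>x. c * f x) n = c * fourier_coeff f n"
proof -
  have "(LINT x:period_cell|lborel. cis (- (frequency n \<bullet> x)) * (c * f x))
      = (LINT x:period_cell|lborel. c * (cis (- (frequency n \<bullet> x)) * f x))"
    by (simp add: mult_ac)
  then show ?thesis unfolding fourier_coeff_def by simp
qed

lemma fourier_coeff_diff: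
  assumes "continuous_on UNIV f" "continuous_on UNIV g"
  shows "fourier_coeff (\<lambda>x. f x - g x) n = fourier_coeff f n - fourier_coeff g n"
  using fourier_coeff_add[OF assms(1), of "\<lambda>x. (-1) * g x" n] fourier_coeff_cmult[of "-1" g n] assms(2)
  by (simp add: continuous_on_minus)

text \<open>
  Orthogonality of the exponentials follows from integration by parts: both sides of
  \<open>i m\<^sub>k c = i n\<^sub>k c\<close> are coefficients of a derivative of the exponential.
\<close>

lemma fourier_coeff_cis: "fourier_coeff (\<lambda>x. cis (frequency m \<bullet> x)) n = (if m = n then 1 else 0)"
proof (cases "m = n")
  case True
  have "fourier_coeff (\<lambda>x. cis (frequency n \<bullet> x)) n = (LINT x:period_cell|lborel. 1) / of_real ((2 * pi)\<^sup>2)"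
    unfolding fourier_coeff_def by (simp add: cis_mult)
  also have "\<dots> = 1"
    by (simp add: set_lebesgue_integral_def measure_period_cell scaleR_conv_of_real)
  finally show ?thesis using True by simp
next
  case False
  then obtain i where i: "m $ i \<noteq> n $ i" by (auto simp: vec_eq_iff)
  let ?f = "\<lambda>x. cis (frequency m \<bullet> x)"
  have "fourier_coeff (\<lambda>x. \<i> * of_int (m $ i) * ?f x) n = \<i> * of_int (n $ i) * fourier_coeff ?f n"
  proof (rule fourier_coeff_derivative)
    show "?f (x + axis i (2 * pi)) = ?f x" for x
    proof -
      have "frequency m \<bullet> (x + axis i (2 * pi)) = frequency m \<bullet> x + 2 * pi * of_int (m $ i)"
        by (simp add: inner_add_right frequency_axis)
      then have "?f (x + axis i (2 * pi)) = ?f x * cis (2 * pi * of_int (m $ i))"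
        by (simp only: cis_mult)
      moreover have "cis (2 * pi * of_int (m $ i)) = 1" by (rule cis_multiple_2pi) simp
      ultimately show ?thesis by simp
    qed
    show "((\<lambda>h. ?f (x + axis i h)) has_vector_derivative \<i> * of_int (m $ i) * ?f (x + axis i h)) (at h)" for x h
      unfolding inner_add_right frequency_axis cis_conv_exp
      by (auto intro!: derivative_eq_intros has_vector_derivative_real_field simp: algebra_simps)
  qed (intro continuous_intros)+
  then have "(of_int (m $ i) - of_int (n $ i)) * fourier_coeff ?f n = 0"
    unfolding fourier_coeff_cmult by (simp add: algebra_simps)
  then show ?thesis using i False by simp
qed

lemma summable_inverse_one_plus_square: "(\<lambda>a::int. 1 / (1 + (real_of_int a)\<^sup>2)) summable_on UNIV"
proof -
  have "summable (\<lambda>n::nat. 1 / (1 + (real n)\<^sup>2))"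
  proof (rule summable_comparison_test'[OF inverse_power_summable[of 2]])
    show "norm (1 / (1 + (real n)\<^sup>2)) \<le> inverse (real n ^ 2)" if "n \<ge> 1" for n
      using that by (simp add: divide_inverse le_imp_inverse_le)
  qed simp
  then have N: "(\<lambda>n::nat. 1 / (1 + (real n)\<^sup>2)) summable_on UNIV"
    by (subst summable_on_UNIV_nonneg_real_iff) auto
  have "(\<lambda>a::int. 1 / (1 + (real_of_int a)\<^sup>2)) summable_on range int"
    using N by (subst summable_on_reindex) (auto simp: o_def)
  moreover have "(\<lambda>a::int. 1 / (1 + (real_of_int a)\<^sup>2)) summable_on range (\<lambda>n. - int n)"
    using N by (subst summable_on_reindex) (auto simp: o_def inj_on_def)
  ultimately have "(\<lambda>a::int. 1 / (1 + (real_of_int a)\<^sup>2)) summable_on (range int \<union> range (\<lambda>n. - int n))"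
    by (rule summable_on_union)
  moreover have "range int \<union> range (\<lambda>n. - int n) = UNIV"
    by (auto simp: image_iff) (metis int_cases2)
  ultimately show ?thesis by simp
qed

lemma norm_frequency_square: "(norm (frequency n))\<^sup>2 = (of_int (n $ 1))\<^sup>2 + (of_int (n $ 2))\<^sup>2"
  unfolding power2_norm_eq_inner inner_vec_def sum_2 by (simp add: frequency_def power2_eq_square)

lemma summable_inverse_frequency_square:
  "(\<lambda>n. 1 / (1 + (norm (frequency n))\<^sup>2)\<^sup>2) summable_on UNIV"
proof -
  let ?f = "\<lambda>a::int. 1 / (1 + (real_of_int a)\<^sup>2)"
  define K where "K = (\<Sum>\<^sub>\<infinity>a. ?f a)"
  show ?thesis
  proof (rule nonneg_bounded_partial_sums_imp_summable_on[where C = "K * K"])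
    have "(\<Sum>n\<in>F. 1 / (1 + (norm (frequency n))\<^sup>2)\<^sup>2) \<le> K * K" if F: "finite F" for F
    proof -
      define P where "P = (\<lambda>n. n $ 1) ` F"
      define Q where "Q = (\<lambda>n. n $ 2) ` F"
      have "(\<Sum>n\<in>F. 1 / (1 + (norm (frequency n))\<^sup>2)\<^sup>2) \<le> (\<Sum>n\<in>F. ?f (n $ 1) * ?f (n $ 2))"
      proof (rule sum_mono)
        fix n :: "int^2"
        let ?a = "(real_of_int (n $ 1))\<^sup>2" and ?b = "(real_of_int (n $ 2))\<^sup>2"
        \<comment> \<open>This bounds the summand by a product over the two coordinates.\<close>
        have "(1 + ?a) * (1 + ?b) \<le> (1 + (?a + ?b)) * (1 + (?a + ?b))"
          by (intro mult_mono) auto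
        then show "1 / (1 + (norm (frequency n))\<^sup>2)\<^sup>2 \<le> ?f (n $ 1) * ?f (n $ 2)"
          unfolding norm_frequency_square power2_eq_square[of "1 + _"]
          by (simp add: frac_le add_pos_nonneg)
      qed
      also have "\<dots> = (\<Sum>p\<in>(\<lambda>n. (n $ 1, n $ 2)) ` F. ?f (fst p) * ?f (snd p))"
        by (subst sum.reindex) (auto simp: inj_on_def vec_eq_iff forall_2)
      also have "\<dots> \<le> (\<Sum>p\<in>P \<times> Q. ?f (fst p) * ?f (snd p))"
        by (rule sum_mono2) (auto simp: P_def Q_def F)
      also have "\<dots> = (\<Sum>a\<in>P. ?f a) * (\<Sum>b\<in>Q. ?f b)"
        by (simp add: sum_product sum.cartesian_product case_prod_beta)
      also have "\<dots> \<le> K * K"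
        unfolding K_def
        by (intro mult_mono finite_sum_le_infsum summable_inverse_one_plus_square sum_nonneg infsum_nonneg)
          (auto simp: P_def Q_def F)
      finally show ?thesis .
    qed
    then show "\<forall>\<^sub>F F in finite_subsets_at_top UNIV. (\<Sum>n\<in>F. 1 / (1 + (norm (frequency n))\<^sup>2)\<^sup>2) \<le> K * K"
      by (intro eventually_finite_subsets_at_top_weakI)
  qed auto
qed

lemma tame_slice_continuous:
  assumes "tame_smooth w v" "t \<ge> 0"
  shows "continuous_on UNIV (\<lambda>x. v j (t, x))"
  by (rule continuous_on_compose2[of cylinder "v j"])
    (use assms tame_continuous[of 0 w v j] in \<open>auto simp: tame_smooth_def intro!: continuous_intros\<close>)

lemma tame_fourier_coeff_derivative:
  assumes "tame_smooth w v" "t \<ge> 0"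
  shows "fourier_coeff (\<lambda>x. directional_deriv (0, axis i 1) v j (t, x)) n
    = \<i> * of_int (n $ i) * fourier_coeff (\<lambda>x. v j (t, x)) n"
proof (rule fourier_coeff_derivative)
  show "v j (t, x + axis i (2 * pi)) = v j (t, x)" for x
    using assms tame_periodic[of 0 w v t j x i] by (simp add: tame_smooth_def)
qed (rule tame_slice_continuous[OF assms] tame_smooth_space_derivative[OF assms]
    tame_slice_continuous[OF tame_smooth_directional_deriv[OF assms(1)] assms(2)])+

text \<open>
  The operator \<open>1 - \<Delta>\<close> preserves tame families and multiplies the \<open>n\<close>-th Fourier coefficient by
  \<open>1 + \<bar>n\<bar>\<^sup>2\<close>; iterating it gives rapid decay of the coefficients, with the same control in \<open>j\<close>.
\<close>

lemma tame_one_minus_laplacian: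
  fixes v :: "nat \<Rightarrow> real \<times> (real^2) \<Rightarrow> complex"
  assumes "tame_smooth w v"
  shows "\<exists>v'. tame_smooth w v' \<and> (\<forall>j t n. t \<ge> 0 \<longrightarrow> fourier_coeff (\<lambda>x. v' j (t, x)) n
    = of_real ((1 + (norm (frequency n))\<^sup>2) ^ m) * fourier_coeff (\<lambda>x. v j (t, x)) n)"
proof (induction m)
  case 0
  then show ?case using assms by auto
next
  case (Suc m)
  then obtain f :: "nat \<Rightarrow> real \<times> (real^2) \<Rightarrow> complex" where f: "tame_smooth w f"
    and fc: "\<And>j t n. t \<ge> 0 \<Longrightarrow> fourier_coeff (\<lambda>x. f j (t, x)) n
      = of_real ((1 + (norm (frequency n))\<^sup>2) ^ m) * fourier_coeff (\<lambda>x. v j (t, x)) n" by blast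
  define D where "D i = directional_deriv (0, axis i 1) (directional_deriv (0, axis i 1) f)" for i :: 2
  have D: "tame_smooth w (D i)" for i unfolding D_def by (intro tame_smooth_directional_deriv f)
  have Dc: "fourier_coeff (\<lambda>x. D i j (t, x)) n = - (of_int (n $ i))\<^sup>2 * fourier_coeff (\<lambda>x. f j (t, x)) n"
    if "t \<ge> 0" for i j t n
    unfolding D_def using that
    by (simp add: tame_fourier_coeff_derivative[OF tame_smooth_directional_deriv[OF f]]
        tame_fourier_coeff_derivative[OF f] power2_eq_square algebra_simps)
  have "tame_smooth w (\<lambda>j z. f j z - D 1 j z - D 2 j z)"
    using f D unfolding tame_smooth_def by (intro allI tame_diff) auto
  moreover have "fourier_coeff (\<lambda>x. f j (t, x) - D 1 j (t, x) - D 2 j (t, x)) n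
      = of_real ((1 + (norm (frequency n))\<^sup>2) ^ Suc m) * fourier_coeff (\<lambda>x. v j (t, x)) n"
    if "t \<ge> 0" for j t n
  proof -
    have "fourier_coeff (\<lambda>x. f j (t, x) - D 1 j (t, x) - D 2 j (t, x)) n
        = fourier_coeff (\<lambda>x. f j (t, x)) n - fourier_coeff (\<lambda>x. D 1 j (t, x)) n
        - fourier_coeff (\<lambda>x. D 2 j (t, x)) n"
    proof -
      have c: "continuous_on UNIV (\<lambda>x. f j (t, x))" "continuous_on UNIV (\<lambda>x. D i j (t, x))" for i
        by (rule tame_slice_continuous[OF f that] tame_slice_continuous[OF D that])+
      show ?thesis
        by (simp only: fourier_coeff_diff[OF continuous_on_diff[OF c(1) c(2)] c(2)] fourier_coeff_diff[OF c])
    qed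
    then show ?thesis using that
      by (simp add: Dc fc norm_frequency_square algebra_simps)
  qed
  ultimately show ?case by (intro exI[of _ "\<lambda>j z. f j z - D 1 j z - D 2 j z"]) auto
qed

lemma tame_fourier_decay:
  fixes v :: "nat \<Rightarrow> real \<times> (real^2) \<Rightarrow> complex"
  assumes "tame_smooth w v"
  obtains C p where "C \<ge> 0" "\<And>j t n. t \<ge> 0 \<Longrightarrow>
    (1 + (norm (frequency n))\<^sup>2) ^ m * cmod (fourier_coeff (\<lambda>x. v j (t, x)) n) \<le> C * (1 + real j) ^ p * w j"
proof -
  obtain f :: "nat \<Rightarrow> real \<times> (real^2) \<Rightarrow> complex" where f: "tame_smooth w f"
    and fc: "\<And>j t n. t \<ge> 0 \<Longrightarrow> fourier_coeff (\<lambda>x. f j (t, x)) n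
      = of_real ((1 + (norm (frequency n))\<^sup>2) ^ m) * fourier_coeff (\<lambda>x. v j (t, x)) n"
    using tame_one_minus_laplacian[OF assms, of m] by blast
  have "tame 0 w f" using f by (simp add: tame_smooth_def)
  then obtain C p where C: "C \<ge> 0" "\<And>j z. z \<in> cylinder \<Longrightarrow> norm (f j z) \<le> C * (1 + real j) ^ p * w j"
    using tame_bound by blast
  show ?thesis
  proof (rule that[OF C(1)])
    fix j n and t :: real assume t: "t \<ge> 0"
    have "cmod (fourier_coeff (\<lambda>x. f j (t, x)) n) \<le> C * (1 + real j) ^ p * w j"
      by (rule norm_fourier_coeff_le) (use t C tame_slice_continuous[OF f] in auto)
    moreover have "cmod (of_real ((1 + (norm (frequency n))\<^sup>2) ^ m)) = (1 + (norm (frequency n))\<^sup>2) ^ m"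
      unfolding norm_of_real by simp
    ultimately show "(1 + (norm (frequency n))\<^sup>2) ^ m * cmod (fourier_coeff (\<lambda>x. v j (t, x)) n)
        \<le> C * (1 + real j) ^ p * w j"
      using fc[OF t, of j n] by (simp only: norm_mult)
  qed
qed

text \<open>
  Convergence has to be proved along with the bound, because \<^const>\<open>sobolev_norm\<close> takes the value
  \<open>0\<close> for a divergent series; the lower bound on the wave relies on it too.
\<close>

lemma tame_sobolev:
  fixes v :: "nat \<Rightarrow> real \<times> (real^2) \<Rightarrow> complex"
  assumes v: "tame_smooth w v"
  shows "t \<ge> 0 \<Longrightarrow> (\<lambda>n. (1 + (norm (frequency n))\<^sup>2) powr s
      * (cmod (fourier_coeff (\<lambda>x. v j (t, x)) n))\<^sup>2) summable_on UNIV" (is "_ \<Longrightarrow> ?S t j summable_on UNIV")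
    and "\<exists>C p. \<forall>j. \<forall>t\<ge>0. sobolev_norm s (\<lambda>x. v j (t, x)) \<le> C * (1 + real j) ^ p * w j"
proof -
  \<comment> \<open>With \<open>2 m \<ge> s + 2\<close> the decay of the squared coefficients beats the weight by \<open>(1 + \<bar>n\<bar>\<^sup>2)\<^sup>-\<^sup>2\<close>, which is summable in two dimensions.\<close>
  obtain m :: nat where m: "s + 2 \<le> 2 * real m" 
    by (metis mult.commute pos_divide_le_eq real_arch_simple zero_less_numeral)
  obtain C p where C: "C \<ge> 0" "\<And>j t n. t \<ge> 0 \<Longrightarrow>
    (1 + (norm (frequency n))\<^sup>2) ^ m * cmod (fourier_coeff (\<lambda>x. v j (t, x)) n) \<le> C * (1 + real j) ^ p * w j"
    using tame_fourier_decay[OF v] by blast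
  define B where "B j = C * (1 + real j) ^ p * w j" for j
  have wn: "w j \<ge> 0" for j using v tame_weight_nonneg unfolding tame_smooth_def by blast
  have B: "B j \<ge> 0" for j using C(1) wn by (simp add: B_def)
  have S: "?S t j n \<le> (B j)\<^sup>2 * (1 / (1 + (norm (frequency n))\<^sup>2)\<^sup>2)" if t: "t \<ge> 0" for t j n
  proof -
    define r where "r = 1 + (norm (frequency n))\<^sup>2"
    define c where "c = cmod (fourier_coeff (\<lambda>x. v j (t, x)) n)"
    have r: "r \<ge> 1" by (simp add: r_def)
    have "r powr s * r\<^sup>2 = r powr (s + 2)" using r by (simp add: powr_add powr_realpow flip: powr_numeral)
    also have "\<dots> \<le> r powr (real (m + m))" using r m by (intro powr_mono) auto
    also have "\<dots> = r ^ m * r ^ m" using r by (subst powr_realpow) (auto simp: power_add)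
    finally have "r powr s * r\<^sup>2 * c\<^sup>2 \<le> (r ^ m * r ^ m) * c\<^sup>2" by (intro mult_right_mono) auto
    also have "\<dots> = (r ^ m * c)\<^sup>2" by (simp add: power2_eq_square)
    also have "\<dots> \<le> (B j)\<^sup>2"
      using C(2)[OF t, of n j] r by (intro power_mono) (auto simp: B_def r_def c_def)
    finally have "(r powr s * c\<^sup>2) * r\<^sup>2 \<le> (B j)\<^sup>2" by (simp add: mult_ac)
    then have "r powr s * c\<^sup>2 \<le> (B j)\<^sup>2 / r\<^sup>2" using r by (subst pos_le_divide_eq) auto
    then show ?thesis by (simp add: r_def c_def)
  qed
  have sm: "(\<lambda>n. (B j)\<^sup>2 * (1 / (1 + (norm (frequency n))\<^sup>2)\<^sup>2)) summable_on UNIV" for j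
    by (intro summable_on_cmult_right summable_inverse_frequency_square)
  have summ: "?S t j summable_on UNIV" if "t \<ge> 0" for t j
    by (rule summable_on_comparison_test[OF sm S[OF that]]) auto
  then show "t \<ge> 0 \<Longrightarrow> ?S t j summable_on UNIV" .
  define K where "K = (\<Sum>\<^sub>\<infinity>n. 1 / (1 + (norm (frequency n))\<^sup>2)\<^sup>2)"
  have "sobolev_norm s (\<lambda>x. v j (t, x)) \<le> (C * sqrt K) * (1 + real j) ^ p * w j" if t: "t \<ge> 0" for j t
  proof -
    have "(\<Sum>\<^sub>\<infinity>n. ?S t j n) \<le> (\<Sum>\<^sub>\<infinity>n. (B j)\<^sup>2 * (1 / (1 + (norm (frequency n))\<^sup>2)\<^sup>2))"
      by (rule infsum_mono[OF summ[OF t] sm]) (rule S[OF t])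
    also have "\<dots> = (B j)\<^sup>2 * K" unfolding K_def by (rule infsum_cmult_right')
    finally have "sobolev_norm s (\<lambda>x. v j (t, x)) \<le> sqrt ((B j)\<^sup>2 * K)"
      unfolding sobolev_norm_def by simp
    then show ?thesis using B[of j] by (simp add: real_sqrt_mult B_def mult_ac)
  qed
  then show "\<exists>C p. \<forall>j. \<forall>t\<ge>0. sobolev_norm s (\<lambda>x. v j (t, x)) \<le> C * (1 + real j) ^ p * w j" by blast
qed

lemma sobolev_norm_ge_fourier_coeff:
  assumes "(\<lambda>n. (1 + (norm (frequency n))\<^sup>2) powr s * (cmod (fourier_coeff f n))\<^sup>2) summable_on UNIV"
    and "s \<ge> 0"
  shows "norm (frequency n) powr s * cmod (fourier_coeff f n) \<le> sobolev_norm s f"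
proof -
  have "(norm (frequency n) powr s * cmod (fourier_coeff f n))\<^sup>2
      = ((norm (frequency n))\<^sup>2) powr s * (cmod (fourier_coeff f n))\<^sup>2"
    by (simp add: power_mult_distrib power2_eq_square powr_mult)
  also have "\<dots> \<le> (1 + (norm (frequency n))\<^sup>2) powr s * (cmod (fourier_coeff f n))\<^sup>2"
    using assms(2) by (intro mult_right_mono powr_mono2) auto
  also have "\<dots> \<le> (\<Sum>\<^sub>\<infinity>n. (1 + (norm (frequency n))\<^sup>2) powr s * (cmod (fourier_coeff f n))\<^sup>2)"
    using finite_sum_le_infsum[OF assms(1), of "{n}"] by simp
  finally show ?thesis unfolding sobolev_norm_def by (rule real_le_rsqrt)
qed

section \<open>Building blocks: flat cutoffs, a logarithmic series, travelling waves\<close>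

text \<open>
  With \<open>y = 1 / x\<close> this bounds all derivatives of \<open>exp (- 1 / x)\<close>, up to and including \<open>x = 0\<close>.
\<close>

lemma poly_times_exp_bounded: "\<exists>B\<ge>0. \<forall>y\<ge>0. \<bar>poly p y\<bar> * exp (- y) \<le> (B :: real)"
proof -
  have mono: "y ^ k * exp (- y) \<le> real k ^ k" if "y \<ge> 0" for k and y :: real
  proof (cases "k = 0")
    case False
    have "(y / real k) ^ k \<le> (1 + y / real k) ^ k" using that by (intro power_mono) auto
    also have "\<dots> \<le> exp y"
      using that False by (intro exp_ge_one_plus_x_over_n_power_n) (auto simp: order_trans[of _ 0])
    finally show ?thesis using False by (simp add: power_divide exp_minus field_simps)
  qed (use that in simp)
  have "\<bar>poly p y\<bar> * exp (- y) \<le> (\<Sum>i\<le>degree p. \<bar>coeff p i\<bar> * real i ^ i)" if "y \<ge> 0" for y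
  proof -
    have "\<bar>poly p y\<bar> \<le> (\<Sum>i\<le>degree p. \<bar>coeff p i\<bar> * y ^ i)"
      unfolding poly_altdef using that
      by (intro order_trans[OF sum_abs]) (simp add: abs_mult)
    then have "\<bar>poly p y\<bar> * exp (- y) \<le> (\<Sum>i\<le>degree p. \<bar>coeff p i\<bar> * y ^ i) * exp (- y)"
      by (intro mult_right_mono) auto
    also have "\<dots> = (\<Sum>i\<le>degree p. \<bar>coeff p i\<bar> * (y ^ i * exp (- y)))"
      by (simp add: sum_distrib_right mult.assoc)
    also have "\<dots> \<le> (\<Sum>i\<le>degree p. \<bar>coeff p i\<bar> * real i ^ i)"
      using mono[OF that] by (intro sum_mono mult_left_mono) auto
    finally show ?thesis .
  qed
  then show ?thesis by (intro exI[of _ "\<Sum>i\<le>degree p. \<bar>coeff p i\<bar> * real i ^ i"]) (auto intro: sum_nonneg)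
qed

primrec flat_poly :: "nat \<Rightarrow> real poly" where
  "flat_poly 0 = 1"
| "flat_poly (Suc n) = [:0, 0, 1:] * (flat_poly n - pderiv (flat_poly n))"

text \<open>\<open>flat n\<close> is the \<open>n\<close>-th derivative of the function equal to \<open>exp (- 1 / x)\<close> for \<open>x > 0\<close> and to \<open>0\<close> elsewhere.\<close>

definition flat :: "nat \<Rightarrow> real \<Rightarrow> real" where
  "flat n x = (if x > 0 then poly (flat_poly n) (1 / x) * exp (- (1 / x)) else 0)"

lemma flat_nonpos: "x \<le> 0 \<Longrightarrow> flat n x = 0"
  by (simp add: flat_def)

lemma flat_bounded: "\<exists>B\<ge>0. \<forall>x. \<bar>flat n x\<bar> \<le> B"
  using poly_times_exp_bounded[of "flat_poly n"] by (auto simp: flat_def abs_mult)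

lemma flat_0_bounds: "0 \<le> flat 0 x" "flat 0 x \<le> 1"
  by (auto simp: flat_def)

lemma flat_0_mono: "x \<le> y \<Longrightarrow> flat 0 x \<le> flat 0 y"
  by (auto simp: flat_def frac_le)

lemma flat_deriv: "(flat n has_real_derivative flat (Suc n) x) (at x)"
proof -
  consider "x > 0" | "x < 0" | "x = 0" by linarith
  then show ?thesis
  proof cases
    case 1
    have "((\<lambda>x. poly (flat_poly n) (1 / x) * exp (- (1 / x))) has_real_derivative flat (Suc n) x) (at x)"
      using 1 by (auto intro!: derivative_eq_intros DERIV_chain2[OF poly_DERIV]
          simp: flat_def power2_eq_square field_simps)
    then show ?thesis
      by (rule has_field_derivative_transform_within_open[where S = "{0<..}"]) (use 1 in \<open>auto simp: flat_def\<close>)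
  next
    case 2
    have "((\<lambda>x. 0) has_real_derivative flat (Suc n) x) (at x)"
      using 2 by (simp add: flat_def)
    then show ?thesis
      by (rule has_field_derivative_transform_within_open[where S = "{..<0}"]) (use 2 in \<open>auto simp: flat_def\<close>)
  next
    case 3
    obtain B where B: "B \<ge> 0" "\<And>y. y \<ge> 0 \<Longrightarrow> \<bar>poly ([:0, 0, 1:] * flat_poly n) y\<bar> * exp (- y) \<le> B"
      using poly_times_exp_bounded by blast
    \<comment> \<open>At the origin the quadratic bound forces the derivative to vanish.\<close>
    have quad: "\<bar>flat n h\<bar> \<le> B * h\<^sup>2" for h
    proof (cases "h > 0")
      case True
      then have "\<bar>poly ([:0, 0, 1:] * flat_poly n) (1 / h)\<bar> * exp (- (1 / h)) \<le> B" by (intro B) auto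
      moreover have "poly ([:0, 0, 1:] * flat_poly n) (1 / h) = poly (flat_poly n) (1 / h) / h\<^sup>2"
        using True by (simp add: power2_eq_square)
      ultimately show ?thesis using True by (simp add: flat_def abs_mult field_simps power2_eq_square)
    qed (use B in \<open>simp add: flat_def\<close>)
    have "((\<lambda>h. (flat n (0 + h) - flat n 0) / h) \<longlongrightarrow> 0) (at 0)"
    proof (rule Lim_null_comparison)
      show "\<forall>\<^sub>F h in at 0. norm ((flat n (0 + h) - flat n 0) / h) \<le> B * \<bar>h\<bar>"
      proof (rule eventually_at_filter[THEN iffD2], intro always_eventually allI impI)
        fix h :: real assume "h \<noteq> 0"
        then show "norm ((flat n (0 + h) - flat n 0) / h) \<le> B * \<bar>h\<bar>"
          using quad[of h] by (simp add: flat_nonpos field_simps power2_eq_square abs_mult_self_eq)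
      qed
      show "((\<lambda>h. B * \<bar>h\<bar>) \<longlongrightarrow> 0) (at 0)"
        by (auto intro!: tendsto_eq_intros)
    qed
    then show ?thesis using 3 by (simp add: DERIV_def flat_nonpos)
  qed
qed

text \<open>
  The power series \<open>log_quotient 0\<close> represents \<open>ln (1 + z) / z\<close>, which is needed near \<open>z = 0\<close>;
  \<open>log_quotient n\<close> is its \<open>n\<close>-th derivative.
\<close>

definition log_quotient :: "nat \<Rightarrow> real \<Rightarrow> real" where
  "log_quotient n z = (\<Sum>k. (diffs ^^ n) (\<lambda>k. (- 1) ^ k / real (Suc k)) k * z ^ k)"

lemma log_quotient_summable:
  "\<bar>z\<bar> < 1 \<Longrightarrow> summable (\<lambda>k. (diffs ^^ n) (\<lambda>k. (- 1) ^ k / real (Suc k)) k * z ^ k)"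
proof (induction n arbitrary: z)
  case 0
  show ?case
  proof (rule summable_comparison_test'[OF summable_geometric[of "\<bar>z\<bar>"]])
    show "norm ((diffs ^^ 0) (\<lambda>k. (- 1) ^ k / real (Suc k)) k * z ^ k) \<le> \<bar>z\<bar> ^ k" if "k \<ge> 0" for k
      by (simp add: abs_mult power_abs field_simps mult_le_cancel_right1 mult_left_le)
  qed (use 0 in simp)
next
  case (Suc n)
  show ?case
    using termdiff_converges[of z 1 "(diffs ^^ n) (\<lambda>k. (- 1) ^ k / real (Suc k))"] Suc by simp
qed

lemma log_quotient_deriv:
  assumes "\<bar>z\<bar> < 1"
  shows "(log_quotient n has_real_derivative log_quotient (Suc n) z) (at z)"
proof -
  have "((\<lambda>z. \<Sum>k. (diffs ^^ n) (\<lambda>k. (- 1) ^ k / real (Suc k)) k * z ^ k) has_real_derivative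
      (\<Sum>k. diffs ((diffs ^^ n) (\<lambda>k. (- 1) ^ k / real (Suc k))) k * z ^ k)) (at z)"
    by (rule termdiffs_strong'[of 1]) (use assms log_quotient_summable in auto)
  then show ?thesis by (simp add: log_quotient_def[abs_def])
qed

text \<open>
  This is the derivative of \<open>z \<cdot> log_quotient 0 z = ln (1 + z)\<close>; only this consequence of the
  closed form enters the computation with the phase.
\<close>

lemma log_quotient_identity:
  assumes "\<bar>z\<bar> < 1"
  shows "log_quotient 0 z + z * log_quotient (Suc 0) z = 1 / (1 + z)"
proof -
  let ?c = "\<lambda>k. (- 1) ^ k / real (Suc k)"
  have 0: "(\<lambda>k. ?c k * z ^ k) sums log_quotient 0 z"
    using log_quotient_summable[OF assms, of 0] by (simp add: log_quotient_def summable_sums)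
  have "(\<lambda>k. real k * ?c k * z ^ (k - Suc 0)) sums (\<Sum>k. diffs ?c k * z ^ k)"
    by (rule diffs_equiv) (use log_quotient_summable[OF assms, of "Suc 0"] in simp)
  then have "(\<lambda>k. real k * ?c k * z ^ (k - Suc 0)) sums log_quotient (Suc 0) z"
    by (simp add: log_quotient_def)
  from sums_mult[OF this, of z] have "(\<lambda>k. z * (real k * ?c k * z ^ (k - Suc 0))) sums (z * log_quotient (Suc 0) z)" .
  moreover have "z * (real k * ?c k * z ^ (k - Suc 0)) = real k * ?c k * z ^ k" for k
    by (cases k) auto
  ultimately have "(\<lambda>k. real k * ?c k * z ^ k) sums (z * log_quotient (Suc 0) z)" by (simp only:)
  from sums_add[OF 0 this] have "(\<lambda>k. ?c k * z ^ k + real k * ?c k * z ^ k) sums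
      (log_quotient 0 z + z * log_quotient (Suc 0) z)" .
  moreover have "?c k * z ^ k + real k * ?c k * z ^ k = (- z) ^ k" for k
  proof -
    have "?c k * z ^ k + real k * ?c k * z ^ k = (real (Suc k) * ?c k) * z ^ k"
      by (simp only: of_nat_Suc distrib_right mult_1_left)
    then show ?thesis by (simp add: power_minus[of z])
  qed
  moreover have "(\<lambda>k. (- z) ^ k) sums (1 / (1 - (- z)))"
    by (rule geometric_sums) (use assms in simp)
  ultimately show ?thesis using sums_unique2 by simp
qed

lemma tame_cos_sin:
  fixes f :: "nat \<Rightarrow> real \<times> (real^2) \<Rightarrow> real"
  assumes "tame k (\<lambda>_. 1) f"
  shows "tame k (\<lambda>_. 1) (\<lambda>j z. cos (f j z))" "tame k (\<lambda>_. 1) (\<lambda>j z. sin (f j z))"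
proof -
  have *: "tame k (\<lambda>_. 1) (\<lambda>j z. sin (f j z + real n * (pi / 2)))" for n
  proof (rule tame_compose[where K = UNIV and G = "\<lambda>n y. sin (y + real n * (pi / 2))", OF assms])
    show "((\<lambda>y. sin (y + real n * (pi / 2))) has_real_derivative sin (y + real (Suc n) * (pi / 2))) (at y)" for n y
    proof -
      have "y + real (Suc n) * (pi / 2) = (y + real n * (pi / 2)) + pi / 2"
        by (simp add: field_simps)
      then have "sin (y + real (Suc n) * (pi / 2)) = sin ((y + real n * (pi / 2)) + pi / 2)"
        by (simp only:)
      also have "\<dots> = cos (y + real n * (pi / 2))" by (simp add: sin_add)
      finally show ?thesis by (auto intro!: derivative_eq_intros)
    qed
    show "bounded (range (\<lambda>y. sin (y + real n * (pi / 2))))" for n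
      by (rule boundedI[where B = 1]) auto
  qed simp
  show "tame k (\<lambda>_. 1) (\<lambda>j z. sin (f j z))" using *[of 0] by simp
  show "tame k (\<lambda>_. 1) (\<lambda>j z. cos (f j z))" using *[of 1] by (simp add: sin_add)
qed

lemma tame_inverse:
  fixes f :: "nat \<Rightarrow> real \<times> (real^2) \<Rightarrow> real"
  assumes "tame k (\<lambda>_. 1) f" and "c > 0" and "\<And>j z. z \<in> cylinder \<Longrightarrow> c \<le> f j z"
  shows "tame k (\<lambda>_. 1) (\<lambda>j z. inverse (f j z))"
proof -
  let ?G = "\<lambda>n y::real. (- 1) ^ n * fact n * inverse y ^ Suc n"
  have "tame k (\<lambda>_. 1) (\<lambda>j z. ?G 0 (f j z))"
  proof (rule tame_compose[where K = "{c..}" and G = ?G, OF assms(1)])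
    show "(?G n has_real_derivative ?G (Suc n) y) (at y)" if "y \<in> {c..}" for n y
    proof -
      have "y \<noteq> 0" using that assms(2) by auto
      from DERIV_cmult[OF DERIV_power[OF DERIV_inverse[OF this], of "Suc n"], of "(- 1) ^ n * fact n"]
      show ?thesis by (rule DERIV_cong) (simp add: algebra_simps)
    qed
    show "bounded (?G n ` {c..})" for n
    proof (rule boundedI[where B = "fact n * inverse c ^ Suc n"])
      fix x assume "x \<in> ?G n ` {c..}"
      then obtain y where y: "y \<ge> c" "x = ?G n y" by auto
      have "inverse y ^ Suc n \<le> inverse c ^ Suc n"
        using y assms(2) by (intro power_mono le_imp_inverse_le) auto
      then show "norm x \<le> fact n * inverse c ^ Suc n"
        using y assms(2) by (simp add: abs_mult power_abs)
    qed
  qed (use assms(3) in simp)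
  then show ?thesis by simp
qed

lemma tame_log_quotient:
  assumes "tame k (\<lambda>_. 1) f" and "c < 1" and "\<And>j z. z \<in> cylinder \<Longrightarrow> \<bar>f j z\<bar> \<le> c"
  shows "tame k (\<lambda>_. 1) (\<lambda>j z. log_quotient 0 (f j z))"
proof (rule tame_compose[where K = "{-c..c}" and G = log_quotient, OF assms(1)])
  show D: "(log_quotient n has_real_derivative log_quotient (Suc n) y) (at y)" if "y \<in> {-c..c}" for n y
    by (rule log_quotient_deriv) (use that assms(2) in auto)
  show "bounded (log_quotient n ` {-c..c})" for n
    by (intro compact_imp_bounded compact_continuous_image DERIV_continuous_on[OF DERIV_subset[OF D]]) auto
qed (use assms(3) in \<open>auto simp: abs_le_iff minus_le_iff\<close>)

text \<open>
  The \<open>j\<close>-th mode lives on the frequency \<open>j + 1\<close> along one coordinate axis. Consecutive modes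
  use different axes, so they can overlap in time without interacting.
\<close>

definition mode_freq :: "nat \<Rightarrow> real" where
  "mode_freq j = real (j + 1)"

definition mode_axis :: "nat \<Rightarrow> 2" where
  "mode_axis j = (if even j then 1 else 2)"

lemma mode_axis_Suc: "mode_axis (Suc j) \<noteq> mode_axis j"
  by (simp add: mode_axis_def)

lemma mode_freq_ge_1: "mode_freq j \<ge> 1"
  by (simp add: mode_freq_def)

text \<open>
  The angle \<open>N x - N\<^sup>2 t\<close> of the free plane wave of frequency \<open>N\<close>.
\<close>

definition mode_angle :: "nat \<Rightarrow> real \<times> (real^2) \<Rightarrow> real" where
  "mode_angle j z = mode_freq j * (snd z $ mode_axis j) - (mode_freq j)\<^sup>2 * fst z"

lemma tame_mode_freq: "tame k (\<lambda>_. 1) (\<lambda>j z. mode_freq j)"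
  by (rule tame_index[where C = 1 and p = 1]) (auto simp: mode_freq_def)

lemma tame_inverse_mode_freq: "tame k (\<lambda>_. 1) (\<lambda>j z. inverse (mode_freq j))"
  by (rule tame_inverse[OF tame_mode_freq, of 1]) (auto simp: mode_freq_ge_1)

text \<open>
  The angle itself is unbounded and not periodic, so it is not tame. The shift \<open>p\<close> keeps the family
  closed under differentiation, as each derivative adds \<open>\<pi>/2\<close>.
\<close>

lemma tame_cos_mode_angle_shift: "tame k (\<lambda>_. 1) (\<lambda>j z. cos (mode_angle j z + p))"
proof (induction k arbitrary: p)
  case 0
  show ?case
  proof (rule tame_0I[where C = 1 and p = 0])
    show "continuous_on cylinder (\<lambda>z. cos (mode_angle j z + p))" for j
      unfolding mode_angle_def by (intro continuous_intros)
    show "cos (mode_angle j (t, x + axis i (2 * pi)) + p) = cos (mode_angle j (t, x) + p)" for j t x i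
    proof (cases "i = mode_axis j")
      case True
      have "mode_angle j (t, x + axis i (2 * pi)) + p = (mode_angle j (t, x) + p) + 2 * real (j + 1) * pi"
        using True by (simp add: mode_angle_def mode_freq_def axis_def algebra_simps)
      then show ?thesis by (simp only: cos_add cos_2npi sin_2npi) simp
    next
      case False
      then show ?thesis by (simp add: mode_angle_def axis_def)
    qed
  qed auto
next
  case (Suc k)
  show ?case
  proof (rule tame_SucI)
    show "tame 0 (\<lambda>_. 1) (\<lambda>j z. cos (mode_angle j z + p))" using Suc.IH by (rule tame_0)
    show "((\<lambda>z. cos (mode_angle j z + p)) has_derivative
        (\<lambda>e. (mode_freq j * (snd e $ mode_axis j) - (mode_freq j * mode_freq j) * fst e)
          * cos (mode_angle j z + (p + pi / 2)))) (at z within cylinder)" for j z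
    proof -
      have "cos (mode_angle j z + (p + pi / 2)) = - sin (mode_angle j z + p)"
        unfolding add.assoc[symmetric] by (simp add: cos_add)
      moreover have "((\<lambda>z. mode_angle j z + p) has_derivative
          (\<lambda>e. mode_freq j * (snd e $ mode_axis j) - (mode_freq j * mode_freq j) * fst e)) (at z within cylinder)"
        unfolding mode_angle_def power2_eq_square
        by (intro has_derivative_eq_rhs[OF has_derivative_add[OF has_derivative_diff[OF
                has_derivative_mult_right[OF bounded_linear.has_derivative[OF bounded_linear_vec_nth
                  has_derivative_snd[OF has_derivative_ident]]]
                has_derivative_mult_right[OF has_derivative_fst[OF has_derivative_ident]]]
              has_derivative_const]]) simp
      ultimately show ?thesis
        using has_derivative_compose[OF _ DERIV_cos[unfolded has_field_derivative_def]]
        by (fastforce simp: mult.commute)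
    qed
    show "tame k (\<lambda>_. 1) (\<lambda>j z. (mode_freq j * (snd e $ mode_axis j) - (mode_freq j * mode_freq j) * fst e)
          * cos (mode_angle j z + (p + pi / 2)))" for e
    proof (intro tame_mult tame_diff Suc.IH tame_mode_freq tame_const)
      show "tame k (\<lambda>_. 1) (\<lambda>j z. snd e $ mode_axis j)"
        by (rule tame_index[where C = "\<bar>snd e $ 1\<bar> + \<bar>snd e $ 2\<bar>" and p = 0]) (auto simp: mode_axis_def)
    qed
  qed
qed

lemma tame_mode_angle:
  "tame k (\<lambda>_. 1) (\<lambda>j z. cos (mode_angle j z))" "tame k (\<lambda>_. 1) (\<lambda>j z. sin (mode_angle j z))"
proof -
  show "tame k (\<lambda>_. 1) (\<lambda>j z. cos (mode_angle j z))" using tame_cos_mode_angle_shift[of k 0] by simp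
  show "tame k (\<lambda>_. 1) (\<lambda>j z. sin (mode_angle j z))"
    using tame_uminus[OF tame_cos_mode_angle_shift[of k "pi / 2"]] by (simp add: cos_add)
qed

text \<open>
  Each derivative in logarithmic time produces a factor \<open>1 / (1 + t)\<close>. Since all cutoffs are bounded
  together with their derivatives, a bound that holds for the power \<open>a\<close> of this factor
  survives any number of differentiations. The sign \<open>r\<close> selects a cutoff that switches on or off.
\<close>

lemma tame_log_time_cutoff:
  assumes "\<bar>r\<bar> = 1" and "\<And>j. w j \<ge> 0"
    and bound: "\<And>n. \<exists>C\<ge>0. \<forall>j. \<forall>t\<ge>0. \<bar>flat n (r * (ln (1 + t) - real j) + 3/4) / (1 + t) ^ a\<bar> \<le> C * w j"
  shows "tame k w (\<lambda>j z. flat n (r * (ln (1 + fst z) - real j) + 3/4) / (1 + fst z) ^ (a + b))"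
proof (induction k arbitrary: n b)
  case 0
  obtain C where C: "C \<ge> 0" "\<And>j t. t \<ge> 0 \<Longrightarrow>
      \<bar>flat n (r * (ln (1 + t) - real j) + 3/4) / (1 + t) ^ a\<bar> \<le> C * w j"
    using bound by blast
  show ?case
  proof (rule tame_0I)
    show "continuous_on cylinder (\<lambda>z. flat n (r * (ln (1 + fst z) - real j) + 3/4) / (1 + fst z) ^ (a + b))" for j
    proof (intro continuous_on_divide)
      have "continuous_on UNIV (flat n)"
        by (rule DERIV_continuous_on) (use flat_deriv in \<open>blast intro: has_field_derivative_at_within\<close>)
      then show "continuous_on cylinder (\<lambda>z. flat n (r * (ln (1 + fst z) - real j) + 3/4))"
        by (rule continuous_on_compose2) (auto intro!: continuous_intros)
      show "continuous_on cylinder (\<lambda>z. (1 + fst z) ^ (a + b))" by (intro continuous_intros)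
    qed auto
    show "norm (flat n (r * (ln (1 + fst z) - real j) + 3/4) / (1 + fst z) ^ (a + b))
        \<le> C * (1 + real j) ^ 0 * w j" if "z \<in> cylinder" for j z
    proof -
      have z: "fst z \<ge> 0" using that by auto
      have "\<bar>flat n (r * (ln (1 + fst z) - real j) + 3/4) / (1 + fst z) ^ a\<bar> / (1 + fst z) ^ b
          \<le> \<bar>flat n (r * (ln (1 + fst z) - real j) + 3/4) / (1 + fst z) ^ a\<bar> / 1"
        using z by (intro divide_left_mono) auto
      then show ?thesis using C(2)[OF z, of j] z by (simp add: power_add abs_mult)
    qed
  qed (use assms(2) in auto)
next
  case (Suc k)
  show ?case
  proof (rule tame_SucI)
    let ?f = "\<lambda>n j z. flat n (r * (ln (1 + fst z) - real j) + 3/4)"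
    show "tame 0 w (\<lambda>j z. ?f n j z / (1 + fst z) ^ (a + b))" using Suc.IH by (rule tame_0)
    show "((\<lambda>z. ?f n j z / (1 + fst z) ^ (a + b)) has_derivative
        (\<lambda>e. fst e * (r * (?f (Suc n) j z / (1 + fst z) ^ (a + Suc b))
          - real (a + b) * (?f n j z / (1 + fst z) ^ (a + Suc b))))) (at z within cylinder)"
      if "z \<in> cylinder" for j z
    proof -
      have z: "1 + fst z > 0" using that by auto
      have g: "((\<lambda>t. flat n (r * (ln (1 + t) - real j) + 3/4) / (1 + t) ^ (a + b)) has_real_derivative
          r * (?f (Suc n) j z / (1 + fst z) ^ (a + Suc b))
          - real (a + b) * (?f n j z / (1 + fst z) ^ (a + Suc b))) (at (fst z))"
      proof -
        have "((\<lambda>t. r * (ln (1 + t) - real j) + 3/4) has_real_derivative r / (1 + fst z)) (at (fst z))"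
          using z by (auto intro!: derivative_eq_intros)
        note F = DERIV_chain2[OF flat_deriv[of n] this]
        have G: "((\<lambda>t. (1 + t) ^ (a + b)) has_real_derivative real (a + b) * (1 + fst z) ^ (a + b - Suc 0)) (at (fst z))"
          by (auto intro!: derivative_eq_intros)
        have alg: "(y' * (r / P) * P ^ m - y * (real m * P ^ (m - Suc 0))) / (P ^ m * P ^ m)
            = r * (y' / P ^ Suc m) - real m * (y / P ^ Suc m)" if "P > 0" for y y' P :: real and m
          using that by (cases m) (simp_all add: field_simps)
        show ?thesis
          by (rule DERIV_cong[OF DERIV_divide[OF F G]]) (use z alg[OF z, of _ "a + b"] in simp_all)
      qed
      show ?thesis
        using has_derivative_compose[OF has_derivative_fst[OF has_derivative_ident]
            g[unfolded has_field_derivative_def], of cylinder]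
        by (simp add: mult.commute)
    qed
    show "tame k w (\<lambda>j z. fst e * (r * (?f (Suc n) j z / (1 + fst z) ^ (a + Suc b))
          - real (a + b) * (?f n j z / (1 + fst z) ^ (a + Suc b))))" for e
      by (intro tame_mult(1)[OF tame_const] tame_diff Suc.IH)
  qed
qed

section \<open>A single mode\<close>

definition cutoff :: "real \<Rightarrow> nat \<Rightarrow> nat \<Rightarrow> real \<Rightarrow> real" where
  "cutoff r n j t = flat n (r * (ln (1 + t) - real j) + 3/4)"

text \<open>
  The mixing angle of the mode: positive exactly when \<open>\<bar>ln (1 + t) - j\<bar> < 3/4\<close>. Consecutive
  bumps overlap, whereas bumps two apart have disjoint supports.
\<close>

definition mixing :: "nat \<Rightarrow> real \<Rightarrow> real" where
  "mixing j t = cutoff 1 0 j t * cutoff (- 1) 0 j t / 2"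

definition mixing_rate :: "nat \<Rightarrow> real \<Rightarrow> real" where
  "mixing_rate j t =
     (cutoff 1 1 j t * cutoff (- 1) 0 j t - cutoff 1 0 j t * cutoff (- 1) 1 j t) / (2 * (1 + t))"

lemma mixing_deriv:
  assumes "t \<ge> 0"
  shows "(mixing j has_real_derivative mixing_rate j t) (at t within A)"
proof -
  have c: "(cutoff r 0 j has_real_derivative cutoff r 1 j t * (r / (1 + t))) (at t)" for r
  proof -
    have "((\<lambda>t. r * (ln (1 + t) - real j) + 3/4) has_real_derivative r / (1 + t)) (at t)"
      using assms by (auto intro!: derivative_eq_intros)
    from DERIV_chain2[OF flat_deriv[of 0] this] show ?thesis
      by (simp add: cutoff_def[abs_def])
  qed
  have alg: "(y' * (1 / P) * z + z' * (- 1 / P) * y) / 2 = (y' * z - y * z') / (2 * P)"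
    if "P > 0" for y y' z z' P :: real
    using that by (simp add: field_simps)
  have "(mixing j has_real_derivative mixing_rate j t) (at t)"
    unfolding mixing_def[abs_def] mixing_rate_def
    by (rule DERIV_cong[OF DERIV_cdivide[OF DERIV_mult[OF c c]]]) (rule alg, use assms in simp)
  then show ?thesis by (rule has_field_derivative_at_within)
qed

lemma mixing_bounds: "0 \<le> mixing j t" "mixing j t \<le> 1/2"
  using flat_0_bounds mult_le_one[of "flat 0 x" "flat 0 y" for x y]
  by (auto simp: mixing_def cutoff_def)

lemma mixing_eq_0:
  assumes "\<bar>ln (1 + t) - real j\<bar> \<ge> 3/4"
  shows "mixing j t = 0" "mixing_rate j t = 0"
proof -
  have "(\<forall>n. cutoff 1 n j t = 0) \<or> (\<forall>n. cutoff (- 1) n j t = 0)"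
    using assms by (cases "ln (1 + t) \<ge> real j") (auto simp: cutoff_def flat_nonpos)
  then show "mixing j t = 0" "mixing_rate j t = 0" by (auto simp: mixing_def mixing_rate_def)
qed

lemma mixing_ge:
  assumes "\<bar>ln (1 + t) - real j\<bar> \<le> 1/2"
  shows "mixing j t \<ge> flat 0 (1/4) * flat 0 (1/4) / 2"
proof -
  have "- (1/2) \<le> ln (1 + t) - real j" "ln (1 + t) - real j \<le> 1/2" using assms by linarith+
  then have "flat 0 (1/4) \<le> cutoff 1 0 j t" "flat 0 (1/4) \<le> cutoff (- 1) 0 j t"
    unfolding cutoff_def by (auto intro!: flat_0_mono)
  then show ?thesis
    unfolding mixing_def by (intro divide_right_mono mult_mono) (auto simp: cutoff_def flat_0_bounds)
qed

lemma tame_cutoff: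
  assumes "\<bar>r\<bar> = 1"
  shows "tame k (\<lambda>_. 1) (\<lambda>j z. cutoff r n j (fst z))"
proof -
  have "tame k (\<lambda>_. 1) (\<lambda>j z. flat n (r * (ln (1 + fst z) - real j) + 3/4) / (1 + fst z) ^ (0 + 0))"
  proof (rule tame_log_time_cutoff[OF assms])
    fix n
    obtain B where "B \<ge> 0" "\<And>x. \<bar>flat n x\<bar> \<le> B" using flat_bounded by blast
    then show "\<exists>C\<ge>0. \<forall>j. \<forall>t\<ge>0. \<bar>flat n (r * (ln (1 + t) - real j) + 3/4) / (1 + t) ^ 0\<bar> \<le> C * 1"
      by (intro exI[of _ B]) simp
  qed simp
  then show ?thesis by (simp add: cutoff_def)
qed

text \<open>
  The \<open>j\<close>-th cutoff is switched on only once \<open>1 + t\<close> exceeds \<open>exp (j - 3/4)\<close>, so a factor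
  \<open>1 / (1 + t)\<close> is worth \<open>exp (- j)\<close>.
\<close>

lemma tame_cutoff_decaying: "tame k (\<lambda>j. exp (- real j)) (\<lambda>j z. cutoff 1 n j (fst z) / (1 + fst z))"
proof -
  have "tame k (\<lambda>j. exp (- real j)) (\<lambda>j z. flat n (1 * (ln (1 + fst z) - real j) + 3/4) / (1 + fst z) ^ (1 + 0))"
  proof (rule tame_log_time_cutoff)
    fix n
    obtain B where B: "B \<ge> 0" "\<And>x. \<bar>flat n x\<bar> \<le> B" using flat_bounded by blast
    have "\<bar>flat n (1 * (ln (1 + t) - real j) + 3/4) / (1 + t) ^ 1\<bar> \<le> (B * exp (3/4)) * exp (- real j)"
      if t: "t \<ge> 0" for t j
    proof (cases "ln (1 + t) - real j + 3/4 \<le> 0")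
      case True
      then show ?thesis using B by (simp add: flat_nonpos)
    next
      case False
      then have "exp (real j - 3/4) \<le> exp (ln (1 + t))" by simp
      then have "exp (real j - 3/4) \<le> 1 + t" using t by simp
      then have "\<bar>flat n (1 * (ln (1 + t) - real j) + 3/4)\<bar> / (1 + t) \<le> B / exp (real j - 3/4)"
        using B t by (intro frac_le) auto
      also have "\<dots> = B * exp (3/4 + - real j)"
        by (simp only: divide_inverse exp_minus[symmetric]) simp
      also have "\<dots> = (B * exp (3/4)) * exp (- real j)"
        by (simp only: exp_add mult.assoc)
      finally show ?thesis using t by (simp add: abs_mult)
    qed
    then show "\<exists>C\<ge>0. \<forall>j. \<forall>t\<ge>0. \<bar>flat n (1 * (ln (1 + t) - real j) + 3/4) / (1 + t) ^ 1\<bar> \<le> C * exp (- real j)"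
      using B(1) by (intro exI[of _ "B * exp (3/4)"]) auto
  qed auto
  then show ?thesis by (simp add: cutoff_def)
qed

lemma tame_mixing: "tame k (\<lambda>_. 1) (\<lambda>j z. mixing j (fst z))"
proof -
  have "tame k (\<lambda>_. 1) (\<lambda>j z. (1/2) * (cutoff 1 0 j (fst z) * cutoff (- 1) 0 j (fst z)))"
    by (intro tame_mult(1)[OF tame_const] tame_mult(1) tame_cutoff) auto
  then show ?thesis by (simp add: mixing_def)
qed

lemma tame_mixing_rate: "tame k (\<lambda>j. exp (- real j)) (\<lambda>j z. mixing_rate j (fst z))"
proof -
  have T: "tame k (\<lambda>j. exp (- real j)) (\<lambda>j z. (1/2) *
      ((cutoff 1 1 j (fst z) / (1 + fst z)) * cutoff (- 1) 0 j (fst z)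
        - (cutoff 1 0 j (fst z) / (1 + fst z)) * cutoff (- 1) 1 j (fst z)))"
    by (intro tame_mult(1)[OF tame_const] tame_diff tame_mult(2)[OF tame_cutoff] tame_cutoff_decaying) auto
  have alg: "(1/2) * (y' / P * z - y / P * z') = (y' * z - y * z') / (2 * P)" if "P > 0"
    for y y' z z' P :: real
    using that by (simp add: field_simps)
  show ?thesis
    by (rule tame_cong[OF _ T]) (simp only: mixing_rate_def, rule alg, auto)
qed

text \<open>
  The density \<open>\<bar>mode_amplitude\<bar>\<^sup>2\<close> of mass, the phase correction that makes this density satisfy the
  continuity equation, and the derivative of the phase along the axis of the mode.
\<close>

definition density :: "nat \<Rightarrow> real \<times> (real^2) \<Rightarrow> real" where
  "density j z = 1 + sin (2 * mixing j (fst z)) * cos (mode_angle j z)"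

definition mode_phase :: "nat \<Rightarrow> real \<times> (real^2) \<Rightarrow> real" where
  "mode_phase j z = mixing_rate j (fst z) * (cos (2 * mixing j (fst z)) * cos (mode_angle j z)
     * log_quotient 0 (sin (2 * mixing j (fst z)) * cos (mode_angle j z))
     * (inverse (mode_freq j) * inverse (mode_freq j)))"

definition mode_phase_x :: "nat \<Rightarrow> real \<times> (real^2) \<Rightarrow> real" where
  "mode_phase_x j z = - (mixing_rate j (fst z) * (cos (2 * mixing j (fst z)) * sin (mode_angle j z)
     * inverse (density j z) * inverse (mode_freq j)))"

definition mode_amplitude :: "nat \<Rightarrow> real \<times> (real^2) \<Rightarrow> complex" where
  "mode_amplitude j z = of_real (cos (mixing j (fst z))) + of_real (sin (mixing j (fst z))) * cis (mode_angle j z)"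

definition mode :: "nat \<Rightarrow> real \<times> (real^2) \<Rightarrow> complex" where
  "mode j z = mode_amplitude j z * cis (mode_phase j z)"

text \<open>
  This is the quotient of \<open>i \<partial>\<^sub>t u + \<Delta> u\<close> by \<open>u\<close> for \<open>u = mode j\<close>, in real form. Every summand
  contains \<^const>\<open>mixing_rate\<close> or is a time derivative of a term that contains it.
\<close>

definition mode_potential :: "nat \<Rightarrow> real \<times> (real^2) \<Rightarrow> real" where
  "mode_potential j z = - (mixing_rate j (fst z) * (sin (mode_angle j z) * inverse (density j z)))
     - directional_deriv (1, 0) mode_phase j z - mode_phase_x j z * mode_phase_x j z
     - mode_phase_x j z * (mode_freq j * (2 * (sin (mixing j (fst z)) * sin (mixing j (fst z)))
         + sin (2 * mixing j (fst z)) * cos (mode_angle j z)) * inverse (density j z))"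

lemma sin_1_less_1: "sin (1::real) < 1"
  using sin_monotone_2pi[of 1 "pi / 2"] pi_gt3 by simp

lemma sin_2_mixing: "0 \<le> sin (2 * mixing j t)" "sin (2 * mixing j t) \<le> sin 1"
proof -
  have m: "0 \<le> 2 * mixing j t" "2 * mixing j t \<le> 1" using mixing_bounds[of j t] by auto
  then show "0 \<le> sin (2 * mixing j t)" using pi_gt3 by (intro sin_ge_zero) auto
  show "sin (2 * mixing j t) \<le> sin 1" using m pi_gt3 by (intro sin_monotone_2pi_le) auto
qed

lemma abs_sin_cos_le: "\<bar>sin (2 * mixing j t) * cos y\<bar> \<le> sin 1"
proof -
  have "\<bar>sin (2 * mixing j t)\<bar> * \<bar>cos y\<bar> \<le> sin 1 * 1"
    using sin_2_mixing[of j t] by (intro mult_mono) auto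
  then show ?thesis by (simp add: abs_mult)
qed

lemma density_ge: "density j z \<ge> 1 - sin 1"
  using abs_sin_cos_le[of j "fst z" "mode_angle j z"] by (auto simp: density_def abs_le_iff)

lemma tame_density_inverse: "tame k (\<lambda>_. 1) (\<lambda>j z. inverse (density j z))"
proof (rule tame_inverse[OF _ _ density_ge])
  show "tame k (\<lambda>_. 1) density"
    unfolding density_def[abs_def]
    by (intro tame_add tame_const tame_mult(1) tame_cos_sin tame_mixing tame_mode_angle)
qed (use sin_1_less_1 in simp)

lemma tame_smooth_mode_phase: "tame_smooth (\<lambda>j. exp (- real j)) mode_phase"
  unfolding tame_smooth_def mode_phase_def[abs_def]
  by (intro allI tame_mult(2)[OF _ tame_mixing_rate] tame_mult(1) tame_cos_sin tame_const tame_mixing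
      tame_mode_angle tame_inverse_mode_freq tame_log_quotient[OF _ sin_1_less_1] abs_sin_cos_le)

lemma tame_mode_phase_x: "tame k (\<lambda>j. exp (- real j)) mode_phase_x"
  unfolding mode_phase_x_def[abs_def]
  by (intro tame_uminus tame_mult(2)[OF _ tame_mixing_rate] tame_mult(1) tame_cos_sin tame_const tame_mixing
      tame_mode_angle tame_inverse_mode_freq tame_density_inverse)

lemma tame_cis:
  assumes "tame k (\<lambda>_. 1) (\<lambda>j z. cos (f j z))" "tame k (\<lambda>_. 1) (\<lambda>j z. sin (f j z))"
  shows "tame k (\<lambda>_. 1) (\<lambda>j z. cis (f j z))"
proof -
  have "tame k (\<lambda>_. 1) (\<lambda>j z. complex_of_real (cos (f j z)) + \<i> * complex_of_real (sin (f j z)))"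
    by (intro tame_add tame_mult(1) tame_const tame_of_real assms)
  then show ?thesis by (simp add: cis_conv_exp exp_Euler cos_of_real sin_of_real)
qed

lemma exp_minus_le_1: "exp (- real j) \<le> 1"
  by simp

lemma tame_smooth_mode: "tame_smooth (\<lambda>_. 1) mode"
proof -
  have "tame k (\<lambda>_. 1) mode_phase" for k
    using tame_smooth_mode_phase unfolding tame_smooth_def
    by (blast intro: tame_weight_mono[where w = "\<lambda>j. exp (- real j)", OF _ exp_minus_le_1])
  then show ?thesis
    unfolding tame_smooth_def mode_def[abs_def] mode_amplitude_def
    by (intro allI tame_mult(1) tame_add tame_of_real tame_cos_sin tame_cis tame_mixing tame_mode_angle)
qed

lemma tame_smooth_mode_potential: "tame_smooth (\<lambda>j. exp (- real j)) mode_potential"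
proof -
  have x: "tame k (\<lambda>_. 1) mode_phase_x" for k
    by (rule tame_weight_mono[OF tame_mode_phase_x exp_minus_le_1])
  have d: "tame k (\<lambda>j. exp (- real j)) (directional_deriv (1, 0) mode_phase)" for k
    using tame_smooth_directional_deriv[OF tame_smooth_mode_phase] by (simp add: tame_smooth_def)
  show ?thesis
    unfolding tame_smooth_def mode_potential_def[abs_def]
    by (intro allI tame_diff tame_uminus d tame_mult(1)[OF x tame_mode_phase_x] tame_mult(2)[OF _ tame_mixing_rate]
        tame_mult(2)[OF _ tame_mode_phase_x] tame_mult(1) tame_add tame_const tame_cos_sin tame_mixing
        tame_mode_angle tame_mode_freq tame_density_inverse)
qed

lemma has_vector_derivative_cis:
  assumes "(g has_real_derivative d) (at x within A)"
  shows "((\<lambda>x. cis (g x)) has_vector_derivative of_real d * (\<i> * cis (g x))) (at x within A)"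
  using has_derivative_cis[OF assms[unfolded has_field_derivative_def]]
  by (simp add: has_vector_derivative_def scaleR_conv_of_real mult_ac)

lemma axis_0: "axis i (0::real) = 0"
  by (simp add: axis_def vec_eq_iff)

lemma mode_angle_axis: "mode_angle j (t, x + axis (mode_axis j) h) = mode_angle j (t, x) + mode_freq j * h"
  by (simp add: mode_angle_def axis_def algebra_simps)

lemma mode_angle_other_axis: "i \<noteq> mode_axis j \<Longrightarrow> mode_angle j (t, x + axis i h) = mode_angle j (t, x)"
  by (simp add: mode_angle_def axis_def)

lemma mode_other_axis: "i \<noteq> mode_axis j \<Longrightarrow> mode j (t, x + axis i h) = mode j (t, x)"
  by (simp add: mode_def mode_amplitude_def mode_phase_def mode_angle_other_axis)

lemma density_pos: "density j z > 0"
  using density_ge[of j z] sin_1_less_1 by linarith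

text \<open>
  The factor \<open>log_quotient 0 (b cos y) \<cdot> cos y\<close> is \<open>ln (1 + b cos y) / b\<close>, whose derivative in \<open>y\<close> is
  \<open>- sin y / (1 + b cos y)\<close>; the power series makes this valid at \<open>b = 0\<close> as well.
\<close>

lemma mode_phase_deriv:
  "((\<lambda>h. mode_phase j (t, x + axis (mode_axis j) h)) has_real_derivative
     mode_phase_x j (t, x + axis (mode_axis j) h)) (at h)"
proof -
  define b where "b = sin (2 * mixing j t)"
  define y where "y = mode_angle j (t, x) + mode_freq j * h"
  define N where "N = mode_freq j"
  have N: "N \<noteq> 0" using mode_freq_ge_1[of j] by (simp add: N_def)
  have b: "\<bar>b * cos y\<bar> < 1" using abs_sin_cos_le[of j t y] sin_1_less_1 by (simp add: b_def)
  have c: "((\<lambda>h. cos (mode_angle j (t, x) + N * h)) has_real_derivative - sin y * N) (at h)"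
    by (auto intro!: derivative_eq_intros simp: y_def N_def)
  have l: "((\<lambda>h. log_quotient 0 (b * cos (mode_angle j (t, x) + N * h))) has_real_derivative
      log_quotient (Suc 0) (b * cos y) * (b * (- sin y * N))) (at h)"
    by (rule DERIV_chain2[OF _ DERIV_cmult[OF c]]) (use log_quotient_deriv[OF b, of 0] in \<open>simp add: y_def N_def\<close>)
  have d: "density j (t, x + axis (mode_axis j) h) = 1 + b * cos y"
    by (simp add: density_def b_def y_def mode_angle_axis)
  have "1 + b * cos y > 0" using density_pos[of j "(t, x + axis (mode_axis j) h)"] d by simp
  have "((\<lambda>h. cos (mode_angle j (t, x) + N * h) * log_quotient 0 (b * cos (mode_angle j (t, x) + N * h)))
      has_real_derivative - sin y * N * inverse (1 + b * cos y)) (at h)"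
  proof (rule DERIV_cong[OF DERIV_mult[OF c l]])
    have "(- sin y * N) * log_quotient 0 (b * cos y)
        + log_quotient (Suc 0) (b * cos y) * (b * (- sin y * N)) * cos y
        = (- sin y * N) * (log_quotient 0 (b * cos y) + b * cos y * log_quotient (Suc 0) (b * cos y))"
      by (simp add: algebra_simps)
    then show "- sin y * N * log_quotient 0 (b * cos (mode_angle j (t, x) + N * h))
        + log_quotient (Suc 0) (b * cos y) * (b * (- sin y * N)) * cos (mode_angle j (t, x) + N * h)
        = - sin y * N * inverse (1 + b * cos y)"
      unfolding log_quotient_identity[OF b] by (simp add: y_def N_def inverse_eq_divide)
  qed
  note D = DERIV_cmult[OF this, of "mixing_rate j t * cos (2 * mixing j t) * (inverse N * inverse N)"]
  have alg: "p * c * (inverse N * inverse N) * (- S * N * r) = - (p * (c * S * r * inverse N))" for p c S r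
    using N by (simp add: field_simps)
  have "mode_phase_x j (t, x + axis (mode_axis j) h) = mixing_rate j t * cos (2 * mixing j t)
      * (inverse N * inverse N) * (- sin y * N * inverse (1 + b * cos y))"
    unfolding alg mode_phase_x_def d by (simp add: mode_angle_axis y_def N_def)
  moreover have "(\<lambda>h. mode_phase j (t, x + axis (mode_axis j) h)) = (\<lambda>h. mixing_rate j t * cos (2 * mixing j t)
      * (inverse N * inverse N) * (cos (mode_angle j (t, x) + N * h)
      * log_quotient 0 (b * cos (mode_angle j (t, x) + N * h))))"
    by (simp add: fun_eq_iff mode_phase_def mode_angle_axis b_def N_def)
  ultimately show ?thesis using D by (simp only:)
qed


lemma mode_phase_x_deriv:
  "((\<lambda>h. mode_phase_x j (t, x + axis (mode_axis j) h)) has_real_derivative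
     - (mixing_rate j t * (cos (2 * mixing j t)
       * (cos (mode_angle j (t, x)) + sin (2 * mixing j t))
       * (inverse (density j (t, x)) * inverse (density j (t, x)))))) (at 0)"
proof -
  define b where "b = sin (2 * mixing j t)"
  define y where "y = mode_angle j (t, x)"
  define N where "N = mode_freq j"
  define r where "r = density j (t, x)"
  have N: "N \<noteq> 0" using mode_freq_ge_1[of j] by (simp add: N_def)
  have r: "r = 1 + b * cos y" "r \<noteq> 0"
    using density_pos[of j "(t, x)"] by (auto simp: r_def density_def b_def y_def)
  have s: "((\<lambda>h. sin (y + N * h)) has_real_derivative cos y * N) (at 0)"
    by (auto intro!: derivative_eq_intros)
  have c: "((\<lambda>h. 1 + b * cos (y + N * h)) has_real_derivative - (b * sin y * N)) (at 0)"
    by (auto intro!: derivative_eq_intros)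
  have "((\<lambda>h. sin (y + N * h) * inverse (1 + b * cos (y + N * h))) has_real_derivative
      N * (cos y + b) * (inverse r * inverse r)) (at 0)"
  proof (rule DERIV_cong[OF DERIV_mult[OF s DERIV_inverse'[OF c]]])
    show "1 + b * cos (y + N * 0) \<noteq> 0" using r by simp
    have "cos y * N * inverse r + - (inverse r * - (b * sin y * N) * inverse r) * sin y
        = N * (cos y * r + b * (sin y * sin y)) * (inverse r * inverse r)"
      using r(2) by (simp add: field_simps)
    also have "cos y * r + b * (sin y * sin y) = cos y + b"
      unfolding r using sin_cos_squared_add3[of y] by algebra
    finally show "cos y * N * inverse (1 + b * cos (y + N * 0))
        + - (inverse (1 + b * cos (y + N * 0)) * - (b * sin y * N) * inverse (1 + b * cos (y + N * 0))) * sin (y + N * 0)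
        = N * (cos y + b) * (inverse r * inverse r)"
      by (simp add: r(1))
  qed
  note D = DERIV_cmult[OF this, of "- (mixing_rate j t * cos (2 * mixing j t) * inverse N)"]
  have "(\<lambda>h. mode_phase_x j (t, x + axis (mode_axis j) h)) = (\<lambda>h. - (mixing_rate j t * cos (2 * mixing j t) * inverse N)
      * (sin (y + N * h) * inverse (1 + b * cos (y + N * h))))"
    by (simp add: fun_eq_iff mode_phase_x_def density_def mode_angle_axis b_def N_def y_def)
  moreover have "- (p * c * inverse N) * (N * q * (i * i)) = - (p * (c * q * (i * i)))" for p c q i
    using N by (simp add: field_simps)
  ultimately show ?thesis
    using D unfolding b_def[symmetric] y_def[symmetric] r_def[symmetric] by (simp only:)
qed

text \<open>
  The algebra behind \<open>mode_schrodinger\<close>, after the common factor \<open>e\<^sup>i\<^sup>\<psi>\<close> and the terms with \<open>\<partial>\<^sub>t \<psi>\<close> and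
  \<open>(\<partial>\<^sub>x \<psi>)\<^sup>2\<close> have been removed. Here \<open>s, c\<close> and \<open>S, C\<close> are sine and cosine of the mixing angle and
  of \<open>\<theta>\<close>, \<open>b\<close> and \<open>k\<close> are sine and cosine of the doubled mixing angle, \<open>p\<close> is the mixing rate, and
  \<open>X, XX\<close> are the first two space derivatives of the phase. That the left
  side is a real multiple of the amplitude is the continuity equation.
\<close>

lemma schrodinger_identity:
  fixes s c S C r k b p N :: real
  assumes "s * s + c * c = 1" "S * S + C * C = 1" "r = 1 + b * C" "k = c * c - s * s" "b = 2 * (s * c)"
    and "r \<noteq> 0" "N \<noteq> 0"
    and X: "X = - (p * (k * S * inverse r * inverse N))"
    and XX: "XX = - (p * (k * (C + b) * (inverse r * inverse r)))"
    and e: "e = Complex C S"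
  shows "\<i> * of_real p * (- of_real s + of_real c * e) + 2 * \<i> * of_real X * (of_real s * (of_real N * (\<i> * e)))
      + \<i> * of_real XX * (of_real c + of_real s * e)
    = of_real (- (p * (S * inverse r)) - X * (N * (2 * (s * s) + b * C) * inverse r)) * (of_real c + of_real s * e)"
proof -
  have NX: "N * X = - (p * (k * S * inverse r))"
    using \<open>N \<noteq> 0\<close> by (simp add: X field_simps)
  have i: "r * inverse r = 1" using \<open>r \<noteq> 0\<close> by simp
  have *: "- p * c * S - 2 * (N * X) * s * C - XX * s * S
      = (- (p * (S * inverse r)) - (N * X) * (2 * (s * s) + b * C) * inverse r) * (c + s * C)"
    unfolding NX XX using assms(1-5) i by algebra
  have **: "p * (- s + c * C) - 2 * (N * X) * s * S + XX * (c + s * C)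
      = (- (p * (S * inverse r)) - (N * X) * (2 * (s * s) + b * C) * inverse r) * s * S"
    unfolding NX XX using assms(1-5) i by algebra
  let ?L = "\<i> * of_real p * (- of_real s + of_real c * e) + 2 * \<i> * of_real X * (of_real s * (of_real N * (\<i> * e)))
      + \<i> * of_real XX * (of_real c + of_real s * e)"
  define q where "q = - (p * (S * inverse r)) - X * (N * (2 * (s * s) + b * C) * inverse r)"
  have q: "q = - (p * (S * inverse r)) - (N * X) * (2 * (s * s) + b * C) * inverse r"
    by (simp add: q_def mult_ac)
  have "Re ?L = - p * c * S - 2 * (N * X) * s * C - XX * s * S"
    "Im ?L = p * (- s + c * C) - 2 * (N * X) * s * S + XX * (c + s * C)"
    unfolding e by (simp_all add: algebra_simps)
  moreover have "Re (of_real q * (of_real c + of_real s * e)) = q * (c + s * C)"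
    "Im (of_real q * (of_real c + of_real s * e)) = q * s * S"
    unfolding e by simp_all
  ultimately show ?thesis unfolding complex_eq_iff q_def[symmetric] using * ** unfolding q[symmetric] by (simp only:)
qed

text \<open>
  Writing the mode as \<open>f e\<^sup>i\<^sup>\<psi>\<close>, the free part of \<open>i \<partial>\<^sub>t f + \<partial>\<^sub>x\<^sup>2 f\<close> cancels because \<open>\<theta> = N x - N\<^sup>2 t\<close>;
  what remains is proportional to the mixing rate or comes from derivatives of \<open>\<psi>\<close>, and it is a real
  multiple of \<open>f\<close> by \<open>schrodinger_identity\<close>.
\<close>

lemma mode_schrodinger:
  assumes "t \<ge> 0"
  shows "\<i> * directional_deriv (1, 0) mode j (t, x)
      + directional_deriv (0, axis (mode_axis j) 1) (directional_deriv (0, axis (mode_axis j) 1) mode) j (t, x)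
    = of_real (mode_potential j (t, x)) * mode j (t, x)"
proof -
  define N where "N = mode_freq j"
  let ?c = "mode_axis j"
  let ?d = "directional_deriv (0, axis ?c 1)"
  define f where "f = mode_amplitude j"
  define fx where "fx z = complex_of_real (sin (mixing j (fst z))) * (of_real N * (\<i> * cis (mode_angle j z)))" for z
  define g where "g z = complex_of_real (mode_phase_x j z)" for z
  define w where "w z = cis (mode_phase j z)" for z
  have angle: "((\<lambda>h. mode_angle j (t, y + axis ?c h)) has_real_derivative N) (at h)" for y h
    unfolding mode_angle_axis N_def by (auto intro!: derivative_eq_intros)
  have wx: "((\<lambda>h. w (t, y + axis ?c h)) has_vector_derivative
      g (t, y + axis ?c h) * (\<i> * w (t, y + axis ?c h))) (at h)" for y h
    unfolding w_def g_def by (rule has_vector_derivative_cis[OF mode_phase_deriv])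
  have ex: "((\<lambda>h. cis (mode_angle j (t, y + axis ?c h))) has_vector_derivative
      of_real N * (\<i> * cis (mode_angle j (t, y + axis ?c h)))) (at h)" for y h
    by (rule has_vector_derivative_cis[OF angle])
  have fx: "((\<lambda>h. f (t, y + axis ?c h)) has_vector_derivative fx (t, y + axis ?c h)) (at h)" for y h
    unfolding f_def mode_amplitude_def fx_def fst_conv
    using has_vector_derivative_add[OF has_vector_derivative_const has_vector_derivative_mult_right[OF ex]] by simp
  have fxx: "((\<lambda>h. fx (t, x + axis ?c h)) has_vector_derivative \<i> * of_real N * fx (t, x)) (at 0)"
    using has_vector_derivative_mult_right[OF ex, of "complex_of_real (sin (mixing j t)) * (of_real N * \<i>)" x 0]
    by (simp add: fx_def mult_ac axis_0)
  have gx: "((\<lambda>h. g (t, x + axis ?c h)) has_vector_derivative of_real XX) (at 0)"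
    if "((\<lambda>h. mode_phase_x j (t, x + axis ?c h)) has_real_derivative XX) (at 0)" for XX
    unfolding g_def using that
    by (simp add: has_vector_derivative_of_real has_real_derivative_iff_has_vector_derivative)
  have d1: "?d mode j (t, y) = (fx (t, y) + \<i> * g (t, y) * f (t, y)) * w (t, y)" for y
  proof (rule vector_derivative_unique_at)
    show "((\<lambda>h. mode j (t, y + axis ?c h)) has_vector_derivative ?d mode j (t, y)) (at 0)"
      using tame_smooth_space_derivative[OF tame_smooth_mode assms, of j y ?c 0] by (simp add: axis_0)
    have "((\<lambda>h. f (t, y + axis ?c h) * w (t, y + axis ?c h)) has_vector_derivative
        f (t, y) * (g (t, y) * (\<i> * w (t, y))) + fx (t, y) * w (t, y)) (at 0)"
      using has_vector_derivative_mult[OF fx[of y 0] wx[of y 0]] by (simp add: axis_0)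
    then show "((\<lambda>h. mode j (t, y + axis ?c h)) has_vector_derivative
        (fx (t, y) + \<i> * g (t, y) * f (t, y)) * w (t, y)) (at 0)"
      by (simp add: mode_def f_def w_def algebra_simps)
  qed
  define X where "X = mode_phase_x j (t, x)"
  define XX where "XX = - (mixing_rate j t * (cos (2 * mixing j t)
       * (cos (mode_angle j (t, x)) + sin (2 * mixing j t))
       * (inverse (density j (t, x)) * inverse (density j (t, x)))))"
  define F Fx W where "F = f (t, x)" and "Fx = fx (t, x)" and "W = w (t, x)"
  have d2: "?d (?d mode) j (t, x) = (\<i> * of_real N * Fx + \<i> * of_real XX * F + 2 * \<i> * of_real X * Fx
      - of_real X * of_real X * F) * W"
  proof (rule vector_derivative_unique_at)
    show "((\<lambda>h. ?d mode j (t, x + axis ?c h)) has_vector_derivative ?d (?d mode) j (t, x)) (at 0)"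
      using tame_smooth_space_derivative[OF tame_smooth_directional_deriv[OF tame_smooth_mode] assms, of _ j x ?c 0] by (simp add: axis_0)
    have "((\<lambda>h. (fx (t, x + axis ?c h) + \<i> * (g (t, x + axis ?c h) * f (t, x + axis ?c h))) * w (t, x + axis ?c h))
        has_vector_derivative (Fx + \<i> * (of_real X * F)) * (of_real X * (\<i> * W))
        + (\<i> * of_real N * Fx + \<i> * (of_real X * Fx + of_real XX * F)) * W) (at 0)"
      using has_vector_derivative_mult[OF has_vector_derivative_add[OF fxx
            has_vector_derivative_mult_right[OF has_vector_derivative_mult[OF
                gx[OF mode_phase_x_deriv] fx[of x 0]]]] wx[of x 0], of \<i>]
      by (simp add: F_def Fx_def W_def XX_def X_def g_def axis_0)
    then show "((\<lambda>h. ?d mode j (t, x + axis ?c h)) has_vector_derivative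
        (\<i> * of_real N * Fx + \<i> * of_real XX * F + 2 * \<i> * of_real X * Fx - of_real X * of_real X * F) * W) (at 0)"
      unfolding d1 by (simp add: algebra_simps)
  qed
  define T where "T = directional_deriv (1, 0) mode_phase j (t, x)"
  define e where "e = cis (mode_angle j (t, x))"
  define m p where "m = mixing j t" and "p = mixing_rate j t"
  have mx: "(mixing j has_real_derivative p) (at t within {0..})"
    unfolding p_def by (rule mixing_deriv[OF assms])
  have d3: "directional_deriv (1, 0) mode j (t, x) = (of_real p * (- of_real (sin m) + of_real (cos m) * e)
      + of_real (sin m) * (- of_real (N * N) * (\<i> * e)) + \<i> * of_real T * F) * W"
  proof (rule vector_derivative_unique_within[OF at_within_nonneg_nontrivial[OF assms]])
    show "((\<lambda>\<tau>. mode j (\<tau>, x)) has_vector_derivative directional_deriv (1, 0) mode j (t, x)) (at t within {0..})"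
      by (rule tame_smooth_time_derivative[OF tame_smooth_mode assms])
    have c: "((\<lambda>\<tau>. complex_of_real (cos (mixing j \<tau>))) has_vector_derivative of_real (- (sin m * p))) (at t within {0..})"
      by (rule has_vector_derivative_of_real) (auto intro!: derivative_eq_intros mx simp: m_def)
    have s: "((\<lambda>\<tau>. complex_of_real (sin (mixing j \<tau>))) has_vector_derivative of_real (cos m * p)) (at t within {0..})"
      by (rule has_vector_derivative_of_real) (auto intro!: derivative_eq_intros mx simp: m_def)
    have ang: "((\<lambda>\<tau>. mode_angle j (\<tau>, x)) has_real_derivative - (N * N)) (at t within {0..})"
      unfolding mode_angle_def by (auto intro!: derivative_eq_intros simp: N_def power2_eq_square)
    have "((\<lambda>\<tau>. mode_phase j (\<tau>, x)) has_real_derivative T) (at t within {0..})"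
      unfolding T_def has_real_derivative_iff_has_vector_derivative
      by (rule tame_smooth_time_derivative[OF tame_smooth_mode_phase assms])
    from has_vector_derivative_mult[OF has_vector_derivative_add[OF c
          has_vector_derivative_mult[OF s has_vector_derivative_cis[OF ang]]] has_vector_derivative_cis[OF this]]
    show "((\<lambda>\<tau>. mode j (\<tau>, x)) has_vector_derivative (of_real p * (- of_real (sin m) + of_real (cos m) * e)
      + of_real (sin m) * (- of_real (N * N) * (\<i> * e)) + \<i> * of_real T * F) * W) (at t within {0..})"
      by (simp add: mode_def mode_amplitude_def F_def f_def W_def w_def e_def m_def algebra_simps)
  qed
  define S C r where "S = sin (mode_angle j (t, x))" and "C = cos (mode_angle j (t, x))" and "r = density j (t, x)"
  have F: "F = of_real (cos m) + of_real (sin m) * e"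
    by (simp add: F_def f_def mode_amplitude_def m_def e_def)
  have Fx: "Fx = of_real (sin m) * (of_real N * (\<i> * e))"
    by (simp add: Fx_def fx_def m_def e_def)
  have id: "\<i> * of_real p * (- of_real (sin m) + of_real (cos m) * e) + 2 * \<i> * of_real X * Fx + \<i> * of_real XX * F
    = of_real (- (p * (S * inverse r)) - X * (N * (2 * (sin m * sin m) + sin (2 * m) * C) * inverse r)) * F"
    unfolding F Fx
  proof (rule schrodinger_identity)
    show "sin m * sin m + cos m * cos m = 1" "S * S + C * C = 1"
      by (simp_all add: S_def C_def add.commute sin_cos_squared_add3)
    show "r = 1 + sin (2 * m) * C" by (simp add: r_def density_def m_def C_def)
    show "sin (2 * m) = 2 * (sin m * cos m)" by (simp add: sin_double)
    show "cos (2 * m) = cos m * cos m - sin m * sin m" by (simp add: cos_double power2_eq_square)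
    show "r \<noteq> 0" using density_pos[of j "(t, x)"] by (simp add: r_def)
    show "N \<noteq> 0" using mode_freq_ge_1[of j] by (simp add: N_def)
    show "X = - (p * (cos (2 * m) * S * inverse r * inverse N))"
      by (simp add: X_def mode_phase_x_def p_def m_def S_def r_def N_def)
    show "XX = - (p * (cos (2 * m) * (C + sin (2 * m)) * (inverse r * inverse r)))"
      by (simp add: XX_def p_def m_def C_def r_def)
    show "e = Complex C S" by (simp add: e_def C_def S_def complex_eq_iff)
  qed
  have V: "mode_potential j (t, x) = (- (p * (S * inverse r)) - X * (N * (2 * (sin m * sin m) + sin (2 * m) * C) * inverse r))
      - T - X * X"
    by (simp add: mode_potential_def p_def S_def r_def X_def N_def m_def C_def T_def)
  have "\<i> * directional_deriv (1, 0) mode j (t, x) + ?d (?d mode) j (t, x)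
      = (\<i> * of_real p * (- of_real (sin m) + of_real (cos m) * e) + 2 * \<i> * of_real X * Fx + \<i> * of_real XX * F
         - (of_real T + of_real X * of_real X) * F) * W"
    unfolding d2 d3 by (simp add: Fx algebra_simps)
  also have "\<dots> = of_real (mode_potential j (t, x)) * (F * W)"
  proof -
    have "(of_real q * F - (of_real T + of_real X * of_real X) * F) * W = of_real (q - T - X * X) * (F * W)" for q
      by (simp add: algebra_simps)
    then show ?thesis unfolding id V .
  qed
  also have "F * W = mode j (t, x)"
    by (simp add: F_def f_def W_def w_def mode_def)
  finally show ?thesis .
qed

section \<open>Gluing the modes along logarithmic time\<close>

lemma mode_trivial:
  assumes "\<bar>ln (1 + t) - real j\<bar> \<ge> 3/4"
  shows "mode j (t, x) = 1" "mode_phase j (t, x) = 0"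
  using mixing_eq_0[OF assms] by (simp_all add: mode_def mode_amplitude_def mode_phase_def)

text \<open>
  The potential contains a time derivative of the phase; the strict inequality makes the phase
  vanish on a neighbourhood of \<open>t\<close>.
\<close>

lemma mode_potential_trivial:
  assumes "t \<ge> 0" "\<bar>ln (1 + t) - real j\<bar> > 3/4"
  shows "mode_potential j (t, x) = 0"
proof -
  have "((\<lambda>\<tau>. \<bar>ln (1 + \<tau>) - real j\<bar>) \<longlongrightarrow> \<bar>ln (1 + t) - real j\<bar>) (at t within {0..})"
    using assms(1) by (intro tendsto_intros) auto
  then have "\<forall>\<^sub>F \<tau> in at t within {0..}. 3/4 < \<bar>ln (1 + \<tau>) - real j\<bar>"
    using assms(2) by (rule order_tendstoD)
  then have ev: "\<forall>\<^sub>F \<tau> in at t within {0..}. 0 = mode_phase j (\<tau>, x)"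
    by eventually_elim (simp add: mode_trivial)
  have "((\<lambda>\<tau>. mode_phase j (\<tau>, x)) has_vector_derivative 0) (at t within {0..})"
    unfolding has_vector_derivative_def
    by (rule has_derivative_transform_eventually[OF _ ev]) (use assms in \<open>auto simp: mode_trivial\<close>)
  then have "directional_deriv (1, 0) mode_phase j (t, x) = 0"
    using vector_derivative_unique_within[OF at_within_nonneg_nontrivial[OF assms(1)]
        tame_smooth_time_derivative[OF tame_smooth_mode_phase assms(1)]] by blast
  then show ?thesis
    using mixing_eq_0[of t j] assms(2) by (simp add: mode_potential_def mode_phase_x_def)
qed

definition block_wave :: "nat \<Rightarrow> real \<times> (real^2) \<Rightarrow> complex" where
  "block_wave m z = mode m z * mode (Suc m) z"

definition block_potential :: "nat \<Rightarrow> real \<times> (real^2) \<Rightarrow> real" where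
  "block_potential m z = mode_potential m z + mode_potential (Suc m) z"

lemma tame_smooth_block_wave: "tame_smooth (\<lambda>_. 1) block_wave"
proof -
  have "tame k (\<lambda>_. 1) (\<lambda>m. mode (m + 1))" for k
    using tame_smooth_mode unfolding tame_smooth_def by (intro tame_reindex[where c = 1]) auto
  then show ?thesis
    using tame_smooth_mode unfolding tame_smooth_def block_wave_def[abs_def] by (auto intro: tame_mult(1))
qed

lemma tame_smooth_block_potential: "tame_smooth (\<lambda>j. exp (- real j)) block_potential"
proof -
  have "tame k (\<lambda>j. exp (- real j)) (\<lambda>m. mode_potential (m + 1))" for k
    using tame_smooth_mode_potential unfolding tame_smooth_def
    by (intro tame_reindex[where c = 1 and w = "\<lambda>j. exp (- real j)"]) auto
  then show ?thesis
    using tame_smooth_mode_potential unfolding tame_smooth_def block_potential_def[abs_def]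
    by (auto intro: tame_add)
qed

text \<open>
  During the window of index \<open>m\<close> only the modes \<open>m\<close> and \<open>m + 1\<close> differ from the constant \<open>1\<close>. The
  windows are open and overlap, which is what makes the glued functions smooth.
\<close>

definition window :: "nat \<Rightarrow> real set" where
  "window m = {exp (real m - 1/4) - 1 <..< exp (real m + 5/4) - 1}"

definition active :: "real \<Rightarrow> nat" where
  "active t = nat \<lfloor>ln (1 + t)\<rfloor>"

lemma mem_window:
  assumes "t \<ge> 0"
  shows "t \<in> window m \<longleftrightarrow> real m - 1/4 < ln (1 + t) \<and> ln (1 + t) < real m + 5/4"
proof -
  have "t \<in> window m \<longleftrightarrow> exp (real m - 1/4) < exp (ln (1 + t)) \<and> exp (ln (1 + t)) < exp (real m + 5/4)"
    using assms by (auto simp: window_def)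
  then show ?thesis by (simp only: exp_less_cancel_iff)
qed

lemma open_window: "open (window m)"
  by (simp add: window_def)

lemma active_bounds:
  assumes "t \<ge> 0"
  shows "real (active t) \<le> ln (1 + t)" "ln (1 + t) < real (active t) + 1"
proof -
  have "ln (1 + t) \<ge> 0" using assms by simp
  then have "real (active t) = of_int \<lfloor>ln (1 + t)\<rfloor>" by (simp add: active_def)
  then show "real (active t) \<le> ln (1 + t)" "ln (1 + t) < real (active t) + 1" by linarith+
qed

lemma active_window: "t \<ge> 0 \<Longrightarrow> t \<in> window (active t)"
  using active_bounds[of t] by (simp add: mem_window)

text \<open>
  On an overlap of two windows the mode that is present in only one of the two blocks is
  trivial, since its bump is at distance more than \<open>3/4\<close>.
\<close>

lemma block_eq:
  assumes t: "t \<ge> 0" "t \<in> window m"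
  shows "block_wave (active t) (t, x) = block_wave m (t, x)"
    "block_potential (active t) (t, x) = block_potential m (t, x)"
proof -
  have w: "real m - 1/4 < ln (1 + t)" "ln (1 + t) < real m + 5/4" using t by (auto simp: mem_window)
  have triv: "mode j (t, x) = 1 \<and> mode_potential j (t, x) = 0" if "\<bar>ln (1 + t) - real j\<bar> > 3/4" for j
    using mode_trivial(1)[of t j x] mode_potential_trivial[OF t(1) that] that by auto
  have "active t = m \<or> active t = Suc m \<or> Suc (active t) = m"
    using active_bounds[OF t(1)] w by linarith
  then consider "active t = m" | "active t = Suc m" | "m = Suc (active t)" by blast
  then have "block_wave (active t) (t, x) = block_wave m (t, x)
      \<and> block_potential (active t) (t, x) = block_potential m (t, x)"
  proof cases
    case 2
    then have "\<bar>ln (1 + t) - real m\<bar> > 3/4" "\<bar>ln (1 + t) - real (Suc (Suc m))\<bar> > 3/4"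
      using active_bounds[OF t(1)] w by auto
    then show ?thesis using triv 2 by (simp add: block_wave_def block_potential_def del: of_nat_Suc)
  next
    case 3
    then have "\<bar>ln (1 + t) - real (active t)\<bar> > 3/4" "\<bar>ln (1 + t) - real (Suc m)\<bar> > 3/4"
      using active_bounds[OF t(1)] w by auto
    then show ?thesis using triv 3 by (simp add: block_wave_def block_potential_def del: of_nat_Suc)
  qed simp
  then show "block_wave (active t) (t, x) = block_wave m (t, x)"
    "block_potential (active t) (t, x) = block_potential m (t, x)" by auto
qed

definition wave :: "real \<Rightarrow> real^2 \<Rightarrow> complex" where
  "wave t x = block_wave (active t) (t, x)"

definition potential :: "real \<Rightarrow> real^2 \<Rightarrow> real" where
  "potential t x = block_potential (active t) (t, x)"

lemma smooth_on_cylinder_glue: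
  assumes "tame_smooth w v" and "\<And>t m x. t \<ge> 0 \<Longrightarrow> t \<in> window m \<Longrightarrow> f t x = v m (t, x)"
  shows "smooth_on_cylinder f"
  unfolding smooth_on_cylinder_def
proof (intro conjI allI impI)
  fix t :: real assume t: "t \<ge> 0"
  have "tame 0 w v" using assms(1) by (simp add: tame_smooth_def)
  then show "torus_periodic (f t)"
    unfolding torus_periodic_def assms(2)[OF t active_window[OF t]] using tame_periodic[OF _ t] by blast
next
  fix k
  show "Ck_on k (\<lambda>(t, x). f t x) cylinder"
  proof (rule Ck_on_glue[where g = v and U = "\<lambda>m. window m \<times> UNIV"])
    show "Ck_on k (v m) cylinder" for m k by (rule tame_smooth_Ck_on[OF assms(1)])
    show "open (window m \<times> UNIV)" for m by (intro open_Times open_window open_UNIV)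
    show "cylinder \<subseteq> (\<Union>m. window m \<times> UNIV)" using active_window by fastforce
    show "(case z of (t, x) \<Rightarrow> f t x) = v m z" if "z \<in> cylinder" "z \<in> window m \<times> UNIV" for m z
      using that assms(2) by auto
  qed
qed

lemma glued_time_derivative:
  assumes "tame_smooth w v" and "\<And>t m x. t \<ge> 0 \<Longrightarrow> t \<in> window m \<Longrightarrow> f t x = v m (t, x)"
    and t: "t \<ge> 0" "t \<in> window m"
  shows "time_deriv f t x = directional_deriv (1, 0) v m (t, x)"
proof (rule time_deriv_eqI[OF _ t(1)])
  have ev: "\<forall>\<^sub>F \<tau> in at t within {0..}. v m (\<tau>, x) = f \<tau> x"
    unfolding eventually_at_topological using open_window[of m] t assms(2) by (metis atLeast_iff)
  show "((\<lambda>\<tau>. f \<tau> x) has_vector_derivative directional_deriv (1, 0) v m (t, x)) (at t within {0..})"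
    using tame_smooth_time_derivative[OF assms(1) t(1), of m x] unfolding has_vector_derivative_def
    by (rule has_derivative_transform_eventually[OF _ ev]) (use t assms(2) in auto)
qed

text \<open>
  Time derivatives are local, so those of the glued potential are glued from those of the blocks,
  which form tame families with the same weight.
\<close>

lemma iterated_time_deriv_potential:
  "\<exists>v. tame_smooth (\<lambda>j. exp (- real j)) v \<and>
    (\<forall>t m x. t \<ge> 0 \<longrightarrow> t \<in> window m \<longrightarrow> (time_deriv ^^ k) potential t x = v m (t, x))"
proof (induction k)
  case 0
  show ?case using tame_smooth_block_potential block_eq(2) by (auto simp: potential_def)
next
  case (Suc k)
  then obtain v where v: "tame_smooth (\<lambda>j. exp (- real j)) v"
    "\<And>t m x. t \<ge> 0 \<Longrightarrow> t \<in> window m \<Longrightarrow> (time_deriv ^^ k) potential t x = v m (t, x)" by blast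
  show ?case
    using tame_smooth_directional_deriv[OF v(1)] glued_time_derivative[OF v] by auto
qed

lemma partial_deriv_eqI:
  "((\<lambda>h. f (x + axis i h)) has_vector_derivative y) (at 0) \<Longrightarrow> partial_deriv i f x = y"
  unfolding partial_deriv_def by (rule vector_derivative_at)

lemma partial_deriv_product:
  fixes g :: "real^2 \<Rightarrow> complex"
  assumes "t \<ge> 0" "tame_smooth w v" and "\<And>x h. g (x + axis i h) = g x"
  shows "partial_deriv i (\<lambda>x. v j (t, x) * g x) x = directional_deriv (0, axis i 1) v j (t, x) * g x"
proof (rule partial_deriv_eqI)
  have "((\<lambda>h. v j (t, x + axis i h)) has_vector_derivative directional_deriv (0, axis i 1) v j (t, x)) (at 0)"
    using tame_smooth_space_derivative[OF assms(2,1), of j x i 0] by (simp add: axis_0)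
  then show "((\<lambda>h. v j (t, x + axis i h) * g (x + axis i h)) has_vector_derivative
      directional_deriv (0, axis i 1) v j (t, x) * g x) (at 0)"
    unfolding assms(3) by (rule has_vector_derivative_mult_left)
qed

lemma partial_deriv_twice_product:
  fixes g :: "real^2 \<Rightarrow> complex"
  assumes "t \<ge> 0" "tame_smooth w v" and "\<And>x h. g (x + axis i h) = g x"
  shows "partial_deriv i (partial_deriv i (\<lambda>x. v j (t, x) * g x)) x
    = directional_deriv (0, axis i 1) (directional_deriv (0, axis i 1) v) j (t, x) * g x"
proof -
  have "partial_deriv i (\<lambda>x. v j (t, x) * g x) = (\<lambda>x. directional_deriv (0, axis i 1) v j (t, x) * g x)"
    by (rule ext) (rule partial_deriv_product[OF assms])
  then show ?thesis
    by (simp only:) (rule partial_deriv_product[OF assms(1) tame_smooth_directional_deriv[OF assms(2)] assms(3)])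
qed

text \<open>
  Modes on different axes multiply: the product of two such solutions solves the equation with the
  sum of the potentials.
\<close>

lemma wave_schrodinger:
  assumes t: "t \<ge> 0"
  shows "\<i> * time_deriv wave t x = - laplacian (wave t) x + of_real (potential t x) * wave t x"
proof -
  define m where "m = active t"
  define a b where "a = mode_axis m" and "b = mode_axis (Suc m)"
  let ?A = "mode m (t, x)" and ?B = "mode (Suc m) (t, x)"
  have ab: "a \<noteq> b" using mode_axis_Suc[of m] by (simp add: a_def b_def)
  have "card {a, b} = card (UNIV :: 2 set)" using ab by simp
  then have U: "(UNIV :: 2 set) = {a, b}" by (metis card_subset_eq finite subset_UNIV)
  have w: "t \<in> window m" unfolding m_def by (rule active_window[OF t])
  have "time_deriv wave t x = directional_deriv (1, 0) block_wave m (t, x)"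
    by (rule glued_time_derivative[OF tame_smooth_block_wave _ t w]) (simp add: wave_def block_eq)
  also have "\<dots> = ?A * directional_deriv (1, 0) mode (Suc m) (t, x) + directional_deriv (1, 0) mode m (t, x) * ?B"
  proof (rule vector_derivative_unique_within[OF at_within_nonneg_nontrivial[OF t]
        tame_smooth_time_derivative[OF tame_smooth_block_wave t]])
    show "((\<lambda>\<tau>. block_wave m (\<tau>, x)) has_vector_derivative
        ?A * directional_deriv (1, 0) mode (Suc m) (t, x) + directional_deriv (1, 0) mode m (t, x) * ?B) (at t within {0..})"
      unfolding block_wave_def
      by (intro has_vector_derivative_mult tame_smooth_time_derivative[OF tame_smooth_mode t])
  qed
  finally have td: "time_deriv wave t x = \<dots>" .
  have wt: "wave t = (\<lambda>x. mode m (t, x) * mode (Suc m) (t, x))"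
    by (simp add: fun_eq_iff wave_def block_wave_def m_def)
  have wt': "wave t = (\<lambda>x. mode (Suc m) (t, x) * mode m (t, x))"
    unfolding wt by (simp add: mult.commute)
  have "partial_deriv a (partial_deriv a (wave t)) x
      = directional_deriv (0, axis a 1) (directional_deriv (0, axis a 1) mode) m (t, x) * ?B"
    unfolding wt using ab
    by (intro partial_deriv_twice_product[OF t tame_smooth_mode] mode_other_axis) (auto simp: b_def)
  moreover have "partial_deriv b (partial_deriv b (wave t)) x
      = directional_deriv (0, axis b 1) (directional_deriv (0, axis b 1) mode) (Suc m) (t, x) * ?A"
    unfolding wt' using ab
    by (intro partial_deriv_twice_product[OF t tame_smooth_mode] mode_other_axis) (auto simp: a_def)
  ultimately have lap: "laplacian (wave t) x
      = directional_deriv (0, axis a 1) (directional_deriv (0, axis a 1) mode) m (t, x) * ?B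
      + directional_deriv (0, axis b 1) (directional_deriv (0, axis b 1) mode) (Suc m) (t, x) * ?A"
    unfolding laplacian_def U using ab by simp
  note A = mode_schrodinger[OF t, of m x, folded a_def]
  note B = mode_schrodinger[OF t, of "Suc m" x, folded b_def]
  have "\<i> * time_deriv wave t x + laplacian (wave t) x
      = (\<i> * directional_deriv (1, 0) mode m (t, x)
          + directional_deriv (0, axis a 1) (directional_deriv (0, axis a 1) mode) m (t, x)) * ?B
      + (\<i> * directional_deriv (1, 0) mode (Suc m) (t, x)
          + directional_deriv (0, axis b 1) (directional_deriv (0, axis b 1) mode) (Suc m) (t, x)) * ?A"
    unfolding td lap by (simp add: algebra_simps)
  also have "\<dots> = of_real (potential t x) * wave t x"
    unfolding A B by (simp add: potential_def wave_def block_potential_def block_wave_def m_def algebra_simps)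
  finally show ?thesis by (simp add: algebra_simps eq_diff_eq)
qed

section \<open>Decay of the potential and growth of the wave\<close>

lemma filterlim_active: "filterlim active sequentially at_top"
  unfolding filterlim_at_top
proof
  fix Z :: nat
  have "Z \<le> active t" if "t \<ge> exp (real Z)" for t
  proof -
    have "t > 0" using that by (rule less_le_trans[OF exp_gt_zero])
    then have "real Z \<le> ln (1 + t)" using that by (intro ln_ge_iff[THEN iffD2]) auto
    then show ?thesis by (simp add: active_def le_nat_floor le_floor_iff le_nat_iff)
  qed
  then show "\<forall>\<^sub>F t in at_top. Z \<le> active t"
    by (rule eventually_at_top_linorderI)
qed

lemma poly_exp_tendsto_0: "((\<lambda>m::nat. C * (1 + real m) ^ p * exp (- real m)) \<longlonglongrightarrow> 0)"
proof -
  have "filterlim (\<lambda>m::nat. 1 + real m) at_top sequentially"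
    by (intro filterlim_tendsto_add_at_top[OF tendsto_const] filterlim_real_sequentially)
  from filterlim_compose[OF tendsto_power_div_exp_0[of p] this]
  have "(\<lambda>m::nat. (C * exp 1) * ((1 + real m) ^ p / exp (1 + real m))) \<longlonglongrightarrow> (C * exp 1) * 0"
    by (intro tendsto_mult tendsto_const)
  moreover have "(C * exp 1) * ((1 + real m) ^ p / exp (1 + real m)) = C * (1 + real m) ^ p * exp (- real m)" for m
    by (simp add: exp_add exp_minus field_simps)
  ultimately show ?thesis by simp
qed

lemma sobolev_norm_nonneg: "sobolev_norm s f \<ge> 0"
  unfolding sobolev_norm_def by (intro real_sqrt_ge_zero infsum_nonneg) auto

lemma potential_decay:
  "((\<lambda>t. sobolev_norm s (\<lambda>x. of_real ((time_deriv ^^ k) potential t x))) \<longlongrightarrow> 0) at_top"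
proof -
  obtain v where v: "tame_smooth (\<lambda>j. exp (- real j)) v"
    "\<And>t m x. t \<ge> 0 \<Longrightarrow> t \<in> window m \<Longrightarrow> (time_deriv ^^ k) potential t x = v m (t, x)"
    using iterated_time_deriv_potential by blast
  have "tame_smooth (\<lambda>j. exp (- real j)) (\<lambda>j z. complex_of_real (v j z))"
    using v(1) unfolding tame_smooth_def by (auto intro: tame_of_real)
  from tame_sobolev(2)[OF this, of s] obtain C p where C:
    "\<And>j t. t \<ge> 0 \<Longrightarrow> sobolev_norm s (\<lambda>x. of_real (v j (t, x))) \<le> C * (1 + real j) ^ p * exp (- real j)"
    by blast
  show ?thesis
  proof (rule tendsto_sandwich[OF _ _ tendsto_const filterlim_compose[OF poly_exp_tendsto_0 filterlim_active]])
    show "\<forall>\<^sub>F t in at_top. 0 \<le> sobolev_norm s (\<lambda>x. of_real ((time_deriv ^^ k) potential t x))"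
      by (simp add: sobolev_norm_nonneg)
    show "\<forall>\<^sub>F t in at_top. sobolev_norm s (\<lambda>x. of_real ((time_deriv ^^ k) potential t x))
        \<le> C * (1 + real (active t)) ^ p * exp (- real (active t))"
      using eventually_ge_at_top[of 0] by eventually_elim (simp add: v(2)[OF _ active_window] C)
  qed
qed

definition mode_vector :: "nat \<Rightarrow> int^2" where
  "mode_vector j = axis (mode_axis j) (int (j + 1))"

lemma frequency_mode_vector: "frequency (mode_vector j) = axis (mode_axis j) (mode_freq j)"
  by (simp add: frequency_def mode_vector_def vec_eq_iff axis_def mode_freq_def)

lemma norm_frequency_mode_vector: "norm (frequency (mode_vector j)) = mode_freq j"
  using mode_freq_ge_1[of j] by (simp add: frequency_mode_vector norm_eq_sqrt_inner inner_axis_axis)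

lemma cis_mode_angle:
  "cis (mode_angle j (t, x)) = cis (- ((mode_freq j)\<^sup>2 * t)) * cis (frequency (mode_vector j) \<bullet> x)"
  by (simp add: cis_mult frequency_mode_vector inner_axis' mode_angle_def)

text \<open>
  Expanding the product gives four exponentials, at the frequencies \<open>0\<close>, \<open>n\<^sub>j\<close>, \<open>n\<^sub>k\<close> and \<open>n\<^sub>j + n\<^sub>k\<close>. They are
  distinct since the axes differ, so only one of them contributes at \<open>n\<^sub>j\<close>.
\<close>

lemma fourier_coeff_amplitudes:
  assumes "mode_axis j \<noteq> mode_axis k"
  shows "cmod (fourier_coeff (\<lambda>x. mode_amplitude j (t, x) * mode_amplitude k (t, x)) (mode_vector j))
    = \<bar>sin (mixing j t) * cos (mixing k t)\<bar>"
proof -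
  let ?n = "mode_vector j" and ?n' = "mode_vector k"
  let ?e = "\<lambda>n x. cis (frequency n \<bullet> x)"
  define g h where "g = cis (- ((mode_freq j)\<^sup>2 * t))" and "h = cis (- ((mode_freq k)\<^sup>2 * t))"
  define c s c' s' where "c = complex_of_real (cos (mixing j t))" and "s = complex_of_real (sin (mixing j t))"
    and "c' = complex_of_real (cos (mixing k t))" and "s' = complex_of_real (sin (mixing k t))"
  have ne: "0 \<noteq> ?n" "?n' \<noteq> ?n" "?n + ?n' \<noteq> ?n"
    using assms by (auto simp: mode_vector_def axis_eq_axis vec_eq_iff axis_def)
  have fr: "frequency 0 = 0" "frequency (?n + ?n') = frequency ?n + frequency ?n'"
    by (simp_all add: frequency_def vec_eq_iff)
  have "(\<lambda>x. mode_amplitude j (t, x) * mode_amplitude k (t, x))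
      = (\<lambda>x. (c * c') * ?e 0 x + ((s * c' * g) * ?e ?n x + ((c * s' * h) * ?e ?n' x + (s * s' * g * h) * ?e (?n + ?n') x)))"
  proof
    fix x
    have "mode_amplitude j (t, x) = c + s * (g * ?e ?n x)" "mode_amplitude k (t, x) = c' + s' * (h * ?e ?n' x)"
      by (simp_all add: mode_amplitude_def cis_mode_angle c_def s_def c'_def s'_def g_def h_def)
    then show "mode_amplitude j (t, x) * mode_amplitude k (t, x)
        = (c * c') * ?e 0 x + ((s * c' * g) * ?e ?n x + ((c * s' * h) * ?e ?n' x + (s * s' * g * h) * ?e (?n + ?n') x))"
      unfolding fr inner_add_left cis_mult[symmetric] by (simp add: algebra_simps)
  qed
  then have "fourier_coeff (\<lambda>x. mode_amplitude j (t, x) * mode_amplitude k (t, x)) ?n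
      = (c * c') * fourier_coeff (?e 0) ?n + ((s * c' * g) * fourier_coeff (?e ?n) ?n
        + ((c * s' * h) * fourier_coeff (?e ?n') ?n + (s * s' * g * h) * fourier_coeff (?e (?n + ?n')) ?n))"
    by (simp add: fourier_coeff_add fourier_coeff_cmult continuous_intros)
  also have "\<dots> = s * c' * g"
    unfolding fourier_coeff_cis using ne by simp
  finally show ?thesis by (simp add: norm_mult s_def c'_def g_def abs_mult)
qed

lemma cmod_cis_minus_1: "cmod (cis y - 1) \<le> \<bar>y\<bar>"
proof -
  have "cmod (cis y - 1) = 2 * \<bar>sin (y / 2)\<bar>" using dist_exp_i_1[of y] by (simp add: cis_conv_exp)
  also have "\<dots> \<le> \<bar>y\<bar>" using abs_sin_x_le_abs_x[of "y / 2"] by simp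
  finally show ?thesis .
qed

lemma cmod_mode_amplitude: "cmod (mode_amplitude j z) \<le> 2"
proof -
  have "cmod (mode_amplitude j z) \<le> \<bar>cos (mixing j (fst z))\<bar> + \<bar>sin (mixing j (fst z))\<bar>"
    unfolding mode_amplitude_def by (rule order_trans[OF norm_triangle_ineq]) (simp add: norm_mult)
  then show ?thesis
    using abs_cos_le_one[of "mixing j (fst z)"] abs_sin_le_one[of "mixing j (fst z)"] by linarith
qed

lemma continuous_slice_amplitude: "continuous_on UNIV (\<lambda>x. mode_amplitude j (t, x))"
  unfolding mode_amplitude_def mode_angle_def fst_conv snd_conv by (intro continuous_intros)

text \<open>
  The phases decay, so the coefficient of the product of the modes is close to that of the product of their
  amplitudes; the factor \<open>4\<close> is the bound \<open>2 \<cdot> 2\<close> for the two amplitudes.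
\<close>

lemma fourier_coeff_modes:
  assumes t: "t \<ge> 0" and ax: "mode_axis j \<noteq> mode_axis k"
    and B: "\<And>x. \<bar>mode_phase j (t, x)\<bar> + \<bar>mode_phase k (t, x)\<bar> \<le> B"
  shows "sin (mixing j t) * cos (mixing k t) - 4 * B
    \<le> cmod (fourier_coeff (\<lambda>x. mode j (t, x) * mode k (t, x)) (mode_vector j))"
proof -
  let ?u = "\<lambda>x. mode j (t, x) * mode k (t, x)"
  let ?f = "\<lambda>x. mode_amplitude j (t, x) * mode_amplitude k (t, x)"
  have cf: "continuous_on UNIV ?f" by (intro continuous_intros continuous_slice_amplitude)
  have cu: "continuous_on UNIV ?u" by (intro continuous_intros tame_slice_continuous[OF tame_smooth_mode t])
  have "cmod (fourier_coeff (\<lambda>x. ?u x - ?f x) (mode_vector j)) \<le> 4 * B"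
  proof (rule norm_fourier_coeff_le)
    show "continuous_on UNIV (\<lambda>x. ?u x - ?f x)" by (intro continuous_intros cu cf)
    fix x
    have "?u x - ?f x = ?f x * (cis (mode_phase j (t, x) + mode_phase k (t, x)) - 1)"
      by (simp add: mode_def cis_mult[symmetric] algebra_simps)
    also have "cmod \<dots> \<le> (2 * 2) * B"
      unfolding norm_mult
    proof (intro mult_mono cmod_mode_amplitude)
      show "cmod (cis (mode_phase j (t, x) + mode_phase k (t, x)) - 1) \<le> B"
        using cmod_cis_minus_1[of "mode_phase j (t, x) + mode_phase k (t, x)"] B[of x] by linarith
    qed auto
    finally show "cmod (?u x - ?f x) \<le> 4 * B" by simp
  qed
  then have "cmod (fourier_coeff ?u (mode_vector j) - fourier_coeff ?f (mode_vector j)) \<le> 4 * B"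
    by (simp add: fourier_coeff_diff[OF cu cf])
  moreover have "sin (mixing j t) * cos (mixing k t) \<le> cmod (fourier_coeff ?f (mode_vector j))"
    unfolding fourier_coeff_amplitudes[OF ax] by simp
  ultimately show ?thesis
    using norm_triangle_ineq2[of "fourier_coeff ?f (mode_vector j)" "fourier_coeff ?u (mode_vector j)"]
    by (simp add: norm_minus_commute)
qed

text \<open>
  Choosing \<open>j\<close> among the two active indices such that \<open>\<bar>ln (1 + t) - j\<bar> \<le> 1/2\<close>, the mixing angle of mode
  \<open>j\<close> is bounded below and its frequency \<open>j + 1\<close> is at least \<open>ln t\<close>. So a single Fourier
  coefficient yields the growth rate \<open>(ln t)\<^sup>s\<close>, from which the claimed rate follows.
\<close>

lemma wave_growth:
  assumes "s > 0" "\<delta> > 0"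
  shows "\<exists>c>0. \<forall>\<^sub>F t in at_top. sobolev_norm s (wave t) \<ge> c * (ln t) powr (s * (1 - \<delta>))"
proof -
  \<comment> \<open>The lower bound of \<open>mixing_ge\<close> for the mixing angle within distance \<open>1/2\<close> of the centre of its bump.\<close>
  define a where "a = flat 0 (1/4) * flat 0 (1/4) / 2"
  have a: "0 < a" by (simp add: a_def flat_def)
  have "a \<le> 1/2" using mult_le_one[OF flat_0_bounds(2) flat_0_bounds, of "1/4" "1/4"] by (simp add: a_def)
  define q where "q = sin a * cos (1/2)"
  have q: "q > 0"
    unfolding q_def using a \<open>a \<le> 1/2\<close> pi_gt3 by (intro mult_pos_pos sin_gt_zero cos_gt_zero) auto
  have "tame 0 (\<lambda>j. exp (- real j)) mode_phase" using tame_smooth_mode_phase by (simp add: tame_smooth_def)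
  then obtain C p where C: "C \<ge> 0"
    "\<And>j z. z \<in> cylinder \<Longrightarrow> norm (mode_phase j z) \<le> C * (1 + real j) ^ p * exp (- real j)"
    using tame_bound by blast
  \<comment> \<open>The two phases together are then at most \<open>q / 8\<close>, so the error \<open>4 \<cdot> q / 8\<close> in \<open>fourier_coeff_modes\<close> is half of \<open>q\<close>.\<close>
  have "\<forall>\<^sub>F m in sequentially. C * (1 + real m) ^ p * exp (- real m) < q / 16"
    by (rule order_tendstoD(2)[OF poly_exp_tendsto_0]) (use q in simp)
  moreover have "\<forall>\<^sub>F m in sequentially. C * (1 + real (Suc m)) ^ p * exp (- real (Suc m)) < q / 16"
    by (rule order_tendstoD(2)[OF LIMSEQ_Suc[OF poly_exp_tendsto_0]]) (use q in simp)
  ultimately have "\<forall>\<^sub>F m in sequentially. C * (1 + real m) ^ p * exp (- real m) < q / 16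
      \<and> C * (1 + real (Suc m)) ^ p * exp (- real (Suc m)) < q / 16"
    by (rule eventually_conj)
  from eventually_compose_filterlim[OF this filterlim_active]
  have ev: "\<forall>\<^sub>F t in at_top. C * (1 + real (active t)) ^ p * exp (- real (active t)) < q / 16
      \<and> C * (1 + real (Suc (active t))) ^ p * exp (- real (Suc (active t))) < q / 16" .
  have "\<forall>\<^sub>F t in at_top. sobolev_norm s (wave t) \<ge> (q / 2) * (ln t) powr (s * (1 - \<delta>))"
    using ev eventually_ge_at_top[of "exp 1"]
  proof eventually_elim
    case (elim t)
    define m where "m = active t"
    have t: "t > 0" "t \<ge> 0" using elim(2) less_le_trans[OF exp_gt_zero, of 1 t] by auto
    have ln1: "ln t \<ge> 1" using elim(2) t by (simp add: ln_ge_iff)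
    have ph: "\<bar>mode_phase j (t, x)\<bar> \<le> q / 16" if "j = m \<or> j = Suc m" for j x
      using C(2)[of "(t, x)" j] elim(1) t that unfolding m_def by auto
    have main: "(q / 2) * (ln t) powr (s * (1 - \<delta>)) \<le> sobolev_norm s (wave t)"
      if jk: "(j = m \<and> k = Suc m) \<or> (j = Suc m \<and> k = m)" and near: "\<bar>ln (1 + t) - real j\<bar> \<le> 1/2" for j k
    proof -
      have u: "wave t = (\<lambda>x. mode j (t, x) * mode k (t, x))"
        using jk by (auto simp: fun_eq_iff wave_def block_wave_def m_def)
      have "wave t = (\<lambda>x. block_wave m (t, x))" by (simp add: fun_eq_iff wave_def m_def)
      then have summ: "(\<lambda>n. (1 + (norm (frequency n))\<^sup>2) powr s * (cmod (fourier_coeff (wave t) n))\<^sup>2) summable_on UNIV"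
        using tame_sobolev(1)[OF tame_smooth_block_wave t(2)] by simp
      have "mode_axis j \<noteq> mode_axis k" using jk mode_axis_Suc[of m] by auto
      moreover have "\<bar>mode_phase j (t, x)\<bar> + \<bar>mode_phase k (t, x)\<bar> \<le> q / 8" for x
        using ph[of j x] ph[of k x] jk by auto
      ultimately have "sin (mixing j t) * cos (mixing k t) - 4 * (q / 8)
          \<le> cmod (fourier_coeff (wave t) (mode_vector j))"
        unfolding u by (rule fourier_coeff_modes[OF t(2)])
      moreover have "q \<le> sin (mixing j t) * cos (mixing k t)"
        unfolding q_def
      proof (rule mult_mono)
        have "a \<le> mixing j t" unfolding a_def by (rule mixing_ge[OF near])
        then show "sin a \<le> sin (mixing j t)"
          using mixing_bounds[of j t] a pi_gt3 by (intro sin_monotone_2pi_le) auto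
        show "cos (1/2) \<le> cos (mixing k t)"
          using mixing_bounds[of k t] pi_gt3 by (intro cos_monotone_0_pi_le) auto
        show "0 \<le> sin (mixing j t)" using mixing_bounds[of j t] pi_gt3 by (intro sin_ge_zero) auto
        show "0 \<le> cos (1/2 :: real)" using pi_gt3 by (intro cos_ge_zero) auto
      qed
      ultimately have coef: "q / 2 \<le> cmod (fourier_coeff (wave t) (mode_vector j))" by simp
      have "ln t \<le> ln (1 + t)" using t by simp
      then have N: "ln t \<le> mode_freq j" using near unfolding mode_freq_def by linarith
      have "(ln t) powr (s * (1 - \<delta>)) \<le> (ln t) powr s"
        using ln1 assms by (intro powr_mono) (auto simp: mult_le_cancel_left1)
      also have "\<dots> \<le> mode_freq j powr s"
        using N ln1 assms by (intro powr_mono2) auto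
      finally have "(q / 2) * (ln t) powr (s * (1 - \<delta>)) \<le> cmod (fourier_coeff (wave t) (mode_vector j)) * mode_freq j powr s"
        using coef q by (intro mult_mono) auto
      also have "\<dots> \<le> sobolev_norm s (wave t)"
        using sobolev_norm_ge_fourier_coeff[OF summ, of "mode_vector j"] assms
        by (simp add: norm_frequency_mode_vector mult.commute)
      finally show ?thesis .
    qed
    have "\<bar>ln (1 + t) - real m\<bar> \<le> 1/2 \<or> \<bar>ln (1 + t) - real (Suc m)\<bar> \<le> 1/2"
      using active_bounds[OF t(2)] unfolding m_def by (auto simp: abs_le_iff)
    then show ?case using main[of m "Suc m"] main[of "Suc m" m] by auto
  qed
  then show ?thesis using q by (intro exI[of _ "q / 2"]) auto
qed

theorem theorem1p1:
  shows "\<exists>(V :: real \<Rightarrow> real^2 \<Rightarrow> real) (u :: real \<Rightarrow> real^2 \<Rightarrow> complex).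
    smooth_on_cylinder V \<and> smooth_on_cylinder u \<and>
    (\<forall>t\<ge>0. \<forall>x. \<i> * time_deriv u t x = - laplacian (u t) x + of_real (V t x) * u t x) \<and>
    (\<forall>\<delta>>0. \<forall>s>0. \<exists>c>0. \<forall>\<^sub>F t in at_top.
       sobolev_norm s (u t) \<ge> c * (ln t) powr (s * (1 - \<delta>))) \<and>
    (\<forall>(k::nat) s. s \<ge> 0 \<longrightarrow>
       ((\<lambda>t. sobolev_norm s (\<lambda>x. of_real ((time_deriv ^^ k) V t x))) \<longlongrightarrow> 0) at_top)"
proof (intro exI[of _ potential] exI[of _ wave] conjI allI impI)
  show "smooth_on_cylinder potential"
    by (rule smooth_on_cylinder_glue[OF tame_smooth_block_potential]) (simp add: potential_def block_eq)
  show "smooth_on_cylinder wave"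
    by (rule smooth_on_cylinder_glue[OF tame_smooth_block_wave]) (simp add: wave_def block_eq)
qed (use wave_schrodinger wave_growth potential_decay in blast)+

end
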